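(* (1) For every finite tree $T$ (with at least $4$ vertices), $\textit{VR}(T,2)> \frac 13$. (2) For every $\varepsilon>0$ and every integer $t\ge 2$, there is a finite tree $T$ with $\textit{VR}(T,t)< \frac 13+\varepsilon$.
   Context: The discrete Voronoi game on a finite graph $G$ with $t$ rounds: two players $\mathbf{A}$ and $\mathbf{B}$ alternately claim vertices of $G$, $\mathbf{A}$ first, each player claiming one vertex per round, for $t$ rounds (no vertex may be claimed twice; $G$ has at least $2t$ vertices). Distances are shortest-path distances in $G$. At the end, each vertex strictly closer to the set of $\mathbf{A}$'s claimed vertices than to the set of $\mathbf{B}$'s claimed vertices belongs to $\mathbf{A}$, each vertex strictly closer to $\mathbf{B}$'s set belongs to $\mathbf{B}$, and each vertex at equal distance is tied (each player receives half of it). The Voronoi ratio $\textit{VR}(G,t)$ is the number of vertices belonging to $\mathbf{A}$ plus half the number of tied vertices, divided by $|V(G)|$, when both players play optimally ($\mathbf{A}$ maximizing, $\mathbf{B}$ minimizing). *)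

theory Defs
  imports "Graph_Theory.Graph_Theory"
begin

text \<open>
  A finite simple graph is a \<^term>\<open>pair_graph\<close>: a finite, loop-free, symmetric set of pairs of
  vertices. In such a graph \<^term>\<open>pre_digraph.cycle\<close> also holds of every walk that traverses an
  edge back and forth, so the \<^term>\<open>forest\<close> and \<^term>\<open>tree\<close> of the library are not the undirected
  notions. The cycles of the undirected graph are those of length at least 3.
\<close>

definition simple_tree :: "'a pair_pre_digraph \<Rightarrow> bool" where
  "simple_tree T \<longleftrightarrow> pair_graph T \<and> Digraph_Component.connected (with_proj T) \<and>
     \<not> (\<exists>p. pre_digraph.cycle (with_proj T) p \<and> 3 \<le> length p)"

definition graph_dist :: "'a pair_pre_digraph \<Rightarrow> 'a \<Rightarrow> 'a \<Rightarrow> ereal" where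
  "graph_dist G u v = wf_digraph.\<mu> (with_proj G) (\<lambda>_. 1) u v"

definition graph_setdist :: "'a pair_pre_digraph \<Rightarrow> 'a \<Rightarrow> 'a set \<Rightarrow> ereal" where
  "graph_setdist G v S = (INF s\<in>S. graph_dist G v s)"

definition voronoi_cell :: "'a pair_pre_digraph \<Rightarrow> 'a set \<Rightarrow> 'a set \<Rightarrow> 'a set" where
  "voronoi_cell G A B = {v \<in> pverts G. graph_setdist G v A < graph_setdist G v B}"

definition voronoi_tied :: "'a pair_pre_digraph \<Rightarrow> 'a set \<Rightarrow> 'a set \<Rightarrow> 'a set" where
  "voronoi_tied G A B = {v \<in> pverts G. graph_setdist G v A = graph_setdist G v B}"

definition voronoi_share :: "'a pair_pre_digraph \<Rightarrow> 'a set \<Rightarrow> 'a set \<Rightarrow> real" where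
  "voronoi_share G A B =
     (real (card (voronoi_cell G A B)) + real (card (voronoi_tied G A B)) / 2)
       / real (card (pverts G))"

text \<open>
  Backward induction: \<open>voronoi_value G t A B\<close> is the final share of the first player under optimal
  play when \<open>A\<close> and \<open>B\<close> are already claimed and \<open>t\<close> rounds remain. It is meaningful only if at
  least \<open>2 * t\<close> vertices are unclaimed; otherwise some \<^const>\<open>Max\<close> or \<^const>\<open>Min\<close> is taken over
  the empty set.
\<close>

fun voronoi_value :: "'a pair_pre_digraph \<Rightarrow> nat \<Rightarrow> 'a set \<Rightarrow> 'a set \<Rightarrow> real" where
  "voronoi_value G 0 A B = voronoi_share G A B"
| "voronoi_value G (Suc t) A B =
     (MAX a \<in> pverts G - (A \<union> B).
        MIN b \<in> pverts G - (insert a A \<union> B).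
          voronoi_value G t (insert a A) (insert b B))"

definition VR :: "'a pair_pre_digraph \<Rightarrow> nat \<Rightarrow> real" where
  "VR G t = voronoi_value G t {} {}"

end

theory Submission
  imports Defs
begin

text \<open>
  Lower bound. If every edge entering a set \<open>S\<close> starts at a vertex of \<open>A\<close>, then no vertex outside
  \<open>S\<close> is won by a \<open>B\<close>-vertex inside \<open>S\<close>. Cut off a minimal branch \<open>X\<close>, rooted at \<open>x\<close>, with at
  least \<open>n/3\<close> vertices, and then a minimal such branch \<open>Y\<close>, rooted at \<open>y\<close>, in the rest (if
  there is none, \<open>x\<close> alone leaves only pieces smaller than \<open>n/3\<close>); removing \<open>x\<close> and \<open>y\<close> leaves pieces of size less than \<open>n/3\<close>, except for the middle piece, which may
  reach \<open>n/3\<close>. \<open>A\<close> starts at the one of \<open>x\<close>, \<open>y\<close> whose largest own branch is smaller, say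
  \<open>x\<close>. If \<open>B\<close> does not answer \<open>y\<close>, then \<open>A\<close> takes \<open>y\<close> and \<open>B\<close> is confined to two pieces. If \<open>B\<close>
  answers \<open>y\<close>, then \<open>A\<close> takes the largest branch of \<open>Y\<close>, which compensates for the branch of \<open>X\<close>
  that \<open>B\<close> takes next, so \<open>A\<close> keeps at least \<open>|X| \<ge> n/3\<close>; ties are broken by \<open>|X| \<ge> |Y|\<close>
  and by the middle piece.

  Upper bound. Three parts of equal weight hang on a centre \<open>c\<close>: a star with hub \<open>h\<close>, and two long
  legs carrying bunches of leaves at distances \<open>4^i\<close> from \<open>c\<close>. Whenever \<open>B\<close> holds the inner end of
  a leg and answers each \<open>A\<close>-vertex on it with the next vertex outwards, an \<open>A\<close>-vertex at
  distance \<open>x\<close> wins little more than the distances in \<open>[x/2, x]\<close>, hence at most one bunch. \<open>B\<close>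
  can always secure two of the three parts: against a first move \<open>c\<close> he takes \<open>h\<close> and then the inner
  end of a leg that \<open>A\<close> has not entered; against any other first move he takes \<open>c\<close>.
\<close>

section \<open>Distances and shares\<close>

text \<open>Distances depend on walks only through their lengths, and relation powers allow direct
  induction on the length.\<close>

lemma (in pair_wf_digraph) ex_awalk_length_iff:
  "(\<exists>p. awalk u p v \<and> length p = n) \<longleftrightarrow> u \<in> pverts G \<and> (u, v) \<in> parcs G ^^ n"
proof (induction n arbitrary: u)
  case 0
  then show ?case by (auto simp: awalk_Nil_iff)
next
  case (Suc n)
  show ?case
  proof
    assume "\<exists>p. awalk u p v \<and> length p = Suc n"
    then obtain w p where "(u, w) \<in> parcs G" "awalk w p v" "length p = n"
      by (auto simp: length_Suc_conv awalk_Cons_iff)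
    then show "u \<in> pverts G \<and> (u, v) \<in> parcs G ^^ Suc n"
      using Suc[of w] relpow_Suc_I2[of u w "parcs G" v n] in_arcsD1 by blast
  next
    assume "u \<in> pverts G \<and> (u, v) \<in> parcs G ^^ Suc n"
    then obtain w where w: "(u, w) \<in> parcs G" "(w, v) \<in> parcs G ^^ n"
      by (meson relpow_Suc_D2)
    then obtain p where "awalk w p v" "length p = n"
      using Suc[of w] in_arcsD2 by blast
    then have "awalk u ((u, w) # p) v \<and> length ((u, w) # p) = Suc n"
      using w(1) by (auto simp: awalk_Cons_iff)
    then show "\<exists>p. awalk u p v \<and> length p = Suc n"
      by blast
  qed
qed

locale finite_tree =
  fixes T :: "'a pair_pre_digraph"
  assumes simple_tree: "simple_tree T"
begin

abbreviation "V \<equiv> pverts T"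
abbreviation "E \<equiv> parcs T"

lemma pair_graph: "pair_graph T"
  using simple_tree by (simp add: simple_tree_def)

sublocale pair_graph T
  by (rule pair_graph)

lemma finite_V: "finite V"
  by (rule pair_finite_verts)

lemma E_sym: "(u, v) \<in> E \<Longrightarrow> (v, u) \<in> E"
  by (rule arcs_symmetric)

lemma E_irrefl: "(u, v) \<in> E \<Longrightarrow> u \<noteq> v"
  using pair_no_loops by force

lemma no_long_cycle: "cycle p \<Longrightarrow> length p < 3"
  using simple_tree by (auto simp: simple_tree_def not_le)

lemma ex_walk:
  assumes "u \<in> V" "v \<in> V"
  shows "\<exists>n. (u, v) \<in> E ^^ n"
proof -
  have "Digraph_Component.connected (with_proj T)"
    using simple_tree by (simp add: simple_tree_def)
  then have "strongly_connected (with_proj T)"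
    by (rule symmetric_connected_imp_strongly_connected[OF pair_sym_arcs])
  then have "u \<rightarrow>\<^sup>*\<^bsub>with_proj T\<^esub> v"
    using assms by auto
  then show ?thesis
    using ex_awalk_length_iff reachable_awalk by metis
qed

lemma V_nonempty: "V \<noteq> {}"
  using simple_tree unfolding simple_tree_def connected_def strongly_connected_def by auto

lemma graph_dist_eq_INF:
  assumes "u \<in> V"
  shows "graph_dist T u v = (INF n\<in>{n. (u, v) \<in> E ^^ n}. ereal (real n))"
proof -
  have cost: "awalk_cost (\<lambda>_. 1) p = real (length p)" for p :: "('a \<times> 'a) awalk"
    by (induction p) (auto simp: awalk_cost_def)
  have "{n. (u, v) \<in> E ^^ n} = length ` {p. awalk u p v}"
    using ex_awalk_length_iff assms by (auto simp: image_iff) metis+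
  then show ?thesis
    unfolding graph_dist_def \<mu>_def by (simp add: cost image_comp)
qed

lemma graph_dist_le:
  assumes "u \<in> V" "(u, v) \<in> E ^^ n"
  shows "graph_dist T u v \<le> ereal (real n)"
  unfolding graph_dist_eq_INF[OF assms(1)] using assms(2) by (auto intro: INF_lower)

lemma graph_dist_attained:
  assumes "u \<in> V" "v \<in> V"
  obtains n where "(u, v) \<in> E ^^ n" "graph_dist T u v = ereal (real n)"
proof -
  define n where "n = (LEAST n. (u, v) \<in> E ^^ n)"
  have n: "(u, v) \<in> E ^^ n"
    unfolding n_def using ex_walk[OF assms] by (rule LeastI_ex)
  have "graph_dist T u v = ereal (real n)"
    unfolding graph_dist_eq_INF[OF assms(1)]
    by (intro antisym INF_lower2[OF _ order_refl] INF_greatest)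
      (use n in \<open>auto simp: n_def intro: Least_le\<close>)
  then show thesis using n that by blast
qed

lemma graph_dist_neq_ge_1:
  assumes "u \<in> V" "v \<in> V" "u \<noteq> v"
  shows "1 \<le> graph_dist T u v"
proof -
  obtain n where n: "(u, v) \<in> E ^^ n" "graph_dist T u v = ereal (real n)"
    using graph_dist_attained[OF assms(1,2)] by blast
  then show ?thesis using assms(3) by (cases n) (auto simp: one_ereal_def)
qed

lemma graph_dist_self_less:
  assumes "u \<in> V" "v \<in> V" "u \<noteq> v"
  shows "graph_dist T u u < graph_dist T u v"
proof -
  have "graph_dist T u u \<le> ereal 0"
    using graph_dist_le[OF assms(1), of u 0] by simp
  also have "ereal 0 < 1" by (simp add: one_ereal_def)
  also have "1 \<le> graph_dist T u v" by (rule graph_dist_neq_ge_1[OF assms])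
  finally show ?thesis .
qed

text \<open>Each edge raises \<open>f\<close> by at most 1, so a shortest walk is at least as long
  as the total rise.\<close>

lemma graph_dist_ge_potential:
  fixes f :: "'a \<Rightarrow> nat"
  assumes lip: "\<And>u w. (u, w) \<in> E \<Longrightarrow> f w \<le> Suc (f u)" and "u \<in> V" "v \<in> V"
  shows "ereal (real (f v) - real (f u)) \<le> graph_dist T u v"
proof -
  obtain n where n: "(u, v) \<in> E ^^ n" "graph_dist T u v = ereal (real n)"
    using graph_dist_attained[OF assms(2,3)] by blast
  have "f v \<le> f u + n"
    using n(1)
  proof (induction n arbitrary: v)
    case (Suc n)
    then obtain w where "(u, w) \<in> E ^^ n" "(w, v) \<in> E" by auto
    then show ?case using Suc.IH[of w] lip[of w v] by linarith
  qed simp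
  with n(2) show ?thesis by auto
qed

text \<open>A shortest walk from \<open>v\<close> to \<open>b\<close> has to enter \<open>S\<close>.
  The start of an entering edge lies in \<open>A\<close> and is met strictly before the end of the
  walk.\<close>

lemma separated_closer:
  assumes "v \<in> V" "v \<notin> S" "b \<in> V" "b \<in> S"
    and sep: "\<And>u w. (u, w) \<in> E \<Longrightarrow> u \<notin> S \<Longrightarrow> w \<in> S \<Longrightarrow> u \<in> A"
  shows "\<exists>a\<in>A. graph_dist T v a < graph_dist T v b"
proof -
  obtain n where n: "(v, b) \<in> E ^^ n" "graph_dist T v b = ereal (real n)"
    using graph_dist_attained[OF assms(1,3)] by blast
  have "\<exists>a\<in>A. \<exists>m<n. (v, a) \<in> E ^^ m"
    using n(1) \<open>b \<in> S\<close>
  proof (induction n arbitrary: b)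
    case 0
    then show ?case using \<open>v \<notin> S\<close> by auto
  next
    case (Suc n)
    then obtain u where u: "(v, u) \<in> E ^^ n" "(u, b) \<in> E" by auto
    show ?case
    proof (cases "u \<in> S")
      case True
      then show ?thesis using Suc.IH[OF u(1)] less_Suc_eq by blast
    next
      case False
      then show ?thesis using sep u Suc.prems by blast
    qed
  qed
  then obtain a m where am: "a \<in> A" "m < n" "(v, a) \<in> E ^^ m" by blast
  then have "graph_dist T v a \<le> ereal (real m)"
    using graph_dist_le assms(1) by blast
  also have "\<dots> < graph_dist T v b" using am n by simp
  finally show ?thesis using am by blast
qed

text \<open>The infimum over the finite nonempty \<open>B\<close> is attained, so each
  \<open>b\<close> may be beaten by a different \<open>a\<close>.\<close>

lemma setdist_less:
  assumes "finite B" "B \<noteq> {}"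
    and "\<And>b. b \<in> B \<Longrightarrow> \<exists>a\<in>A. graph_dist T v a < graph_dist T v b"
  shows "graph_setdist T v A < graph_setdist T v B"
proof -
  have "graph_setdist T v B = Min (graph_dist T v ` B)"
    unfolding graph_setdist_def using assms by (simp add: Min_Inf)
  also have "\<dots> \<in> graph_dist T v ` B"
    using assms by (intro Min_in) auto
  finally obtain b where "b \<in> B" "graph_setdist T v B = graph_dist T v b"
    by blast
  then show ?thesis
    using assms(3)[of b] unfolding graph_setdist_def by (auto simp: INF_less_iff)
qed

section \<open>Shares and the value of a position\<close>

text \<open>A vertex of \<open>P\<close> is either tied or won by A, so it counts at least one half;
  \<open>P\<close> need not be split in advance.\<close>

lemma share_lower:
  assumes "W \<subseteq> V" and "\<And>v. v \<in> W \<Longrightarrow> graph_setdist T v A < graph_setdist T v B"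
    and "P \<subseteq> V" and "\<And>v. v \<in> P \<Longrightarrow> graph_setdist T v A \<le> graph_setdist T v B"
    and "W \<inter> P = {}"
  shows "real (card W) + real (card P) / 2 \<le> voronoi_share T A B * real (card V)"
proof -
  let ?C = "voronoi_cell T A B" and ?D = "voronoi_tied T A B"
  have fin: "finite ?C" "finite ?D" "finite W" "finite P"
    using finite_V finite_subset[OF assms(1) finite_V] finite_subset[OF assms(3) finite_V]
    by (auto simp: voronoi_cell_def voronoi_tied_def)
  have "card (W \<union> (P \<inter> ?C)) \<le> card ?C"
    using assms fin by (intro card_mono) (auto simp: voronoi_cell_def)
  moreover have "card (W \<union> (P \<inter> ?C)) = card W + card (P \<inter> ?C)"
    using assms fin by (intro card_Un_disjoint) auto
  moreover have "card (P \<inter> ?D) \<le> card ?D"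
    using fin by (intro card_mono) auto
  moreover have "P = (P \<inter> ?C) \<union> (P \<inter> ?D)"
    using assms by (auto simp: voronoi_cell_def voronoi_tied_def order.order_iff_strict)
  then have "card P \<le> card (P \<inter> ?C) + card (P \<inter> ?D)"
    using card_Un_le by metis
  ultimately have "real (card W) + real (card P) / 2 \<le> real (card ?C) + real (card ?D) / 2"
    by linarith
  then show ?thesis
    unfolding voronoi_share_def using V_nonempty finite_V by simp
qed

lemma share_upper:
  assumes "W \<subseteq> V" and "\<And>v. v \<in> W \<Longrightarrow> graph_setdist T v B < graph_setdist T v A"
  shows "voronoi_share T A B * real (card V) \<le> real (card V) - real (card W)"
proof -
  let ?C = "voronoi_cell T A B" and ?D = "voronoi_tied T A B"
  have fin: "finite ?C" "finite ?D"
    using finite_V by (auto simp: voronoi_cell_def voronoi_tied_def)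
  have "?C \<union> ?D \<subseteq> V - W"
    using assms(2) by (force simp: voronoi_cell_def voronoi_tied_def)
  then have "card (?C \<union> ?D) \<le> card (V - W)"
    using finite_V by (intro card_mono) auto
  moreover have "card (?C \<union> ?D) = card ?C + card ?D"
    using fin by (intro card_Un_disjoint) (auto simp: voronoi_cell_def voronoi_tied_def)
  moreover have "card (V - W) = card V - card W" "card W \<le> card V"
    using card_Diff_subset[OF finite_subset[OF assms(1) finite_V] assms(1)]
      card_mono[OF finite_V assms(1)] by auto
  ultimately have "real (card ?C) + real (card ?D) / 2 \<le> real (card V) - real (card W)"
    by linarith
  then show ?thesis
    unfolding voronoi_share_def using V_nonempty finite_V by simp
qed

lemma voronoi_value_Suc_gt:
  assumes "a \<in> V - (A \<union> B)" "V - (insert a A \<union> B) \<noteq> {}"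
    and "\<And>b. b \<in> V - (insert a A \<union> B) \<Longrightarrow> voronoi_value T t (insert a A) (insert b B) > r"
  shows "voronoi_value T (Suc t) A B > r"
proof -
  have "r < (MIN b \<in> V - (insert a A \<union> B). voronoi_value T t (insert a A) (insert b B))"
    using assms(2,3) finite_V by (subst Min_gr_iff) auto
  also have "\<dots> \<le> voronoi_value T (Suc t) A B"
    unfolding voronoi_value.simps using assms(1) finite_V by (intro Max_ge) auto
  finally show ?thesis .
qed

lemma voronoi_value_Suc_le:
  assumes "V - (A \<union> B) \<noteq> {}"
    and "\<And>a. a \<in> V - (A \<union> B) \<Longrightarrow>
      \<exists>b\<in>V - (insert a A \<union> B). voronoi_value T t (insert a A) (insert b B) \<le> r"
  shows "voronoi_value T (Suc t) A B \<le> r"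
proof -
  have "(MIN b \<in> V - (insert a A \<union> B). voronoi_value T t (insert a A) (insert b B)) \<le> r"
    if a: "a \<in> V - (A \<union> B)" for a
  proof -
    obtain b where "b \<in> V - (insert a A \<union> B)"
      "voronoi_value T t (insert a A) (insert b B) \<le> r"
      using assms(2)[OF a] by blast
    then show ?thesis
      using finite_V by (intro Min.coboundedI[THEN order_trans]) auto
  qed
  then show ?thesis
    unfolding voronoi_value.simps using assms(1) finite_V by (subst Max_le_iff) auto
qed

end

section \<open>The lower bound\<close>

context finite_tree
begin

text \<open>The component of \<open>v\<close> after deletion of the edge between \<open>u\<close>
  and \<open>v\<close>; both orientations have to go, since edges are symmetric pairs.\<close>

definition branch :: "'a \<Rightarrow> 'a \<Rightarrow> 'a set" where
  "branch u v = {w. (v, w) \<in> (E - {(u, v), (v, u)})\<^sup>*}"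

lemma branch_self: "v \<in> branch u v"
  by (simp add: branch_def)

text \<open>Acyclicity enters here: a path from \<open>v\<close> back to \<open>u\<close> avoiding
  the edge would close up with it to a cycle. That path has at least two arcs, because
  \<open>u\<close> and \<open>v\<close> differ and the arc from \<open>v\<close> to \<open>u\<close>
  is deleted, so the cycle has length at least 3.\<close>

lemma not_in_branch:
  assumes uv: "(u, v) \<in> E"
  shows "u \<notin> branch u v"
proof
  assume "u \<in> branch u v"
  define E' where "E' = E - {(u, v), (v, u)}"
  interpret H: pair_wf_digraph "\<lparr>pverts = V, parcs = E'\<rparr>"
    by unfold_locales (auto simp: E'_def in_arcsD1 in_arcsD2)
  obtain n where "(v, u) \<in> E' ^^ n"
    using \<open>u \<in> branch u v\<close> rtrancl_imp_relpow unfolding branch_def E'_def by blast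
  then obtain p0 where "H.awalk v p0 u"
    using H.ex_awalk_length_iff[of v u n] uv in_arcsD2 by auto
  then obtain p where p: "H.apath v p u"
    using H.apath_awalk_to_apath by blast
  have "set p \<subseteq> E'" "pcas v p u" "distinct (pawalk_verts v p)"
    using p by (auto simp: H.apath_def H.awalk_def)
  then have "awalk u ((u, v) # p) u"
    using uv in_arcsD1 by (auto simp: awalk_def E'_def)
  then have "cycle ((u, v) # p)"
    unfolding cycle_def using \<open>distinct (pawalk_verts v p)\<close> by auto
  moreover have "p \<noteq> []" "\<And>e. p \<noteq> [e]"
    using \<open>pcas v p u\<close> \<open>set p \<subseteq> E'\<close> E_irrefl[OF uv] by (auto simp: E'_def)
  then have "length p \<ge> 2"
    by (cases p; cases "tl p") auto
  ultimately show False
    using no_long_cycle by fastforce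
qed

lemma branch_subset:
  assumes "v \<in> V"
  shows "branch u v \<subseteq> V"
proof
  fix w assume "w \<in> branch u v"
  then have "(v, w) \<in> (E - {(u, v), (v, u)})\<^sup>*" by (simp add: branch_def)
  then show "w \<in> V" by cases (use assms in_arcsD2 in auto)
qed

lemma branch_exit:
  assumes "(u, v) \<in> E" "(w, w') \<in> E" "w \<in> branch u v" "w' \<notin> branch u v"
  shows "w = v \<and> w' = u"
proof (rule ccontr)
  assume "\<not> ?thesis"
  then have "(w, w') \<in> E - {(u, v), (v, u)}"
    using assms not_in_branch by auto
  then have "w' \<in> branch u v"
    using assms(3) unfolding branch_def by (auto intro: rtrancl_into_rtrancl)
  with assms(4) show False ..
qed

lemma branch_entry:
  assumes "(u, v) \<in> E" "(w, w') \<in> E" "w \<notin> branch u v" "w' \<in> branch u v"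
  shows "w = u \<and> w' = v"
  using branch_exit[OF assms(1) E_sym[OF assms(2)]] assms by blast

text \<open>A common vertex of both branches would join \<open>v\<close> to \<open>u\<close> without
  the edge, as the remaining edges are symmetric. Conversely, a walk from \<open>v\<close> can
  change sides only along the deleted edge, so it never leaves the union.\<close>

lemma branch_swap:
  assumes uv: "(u, v) \<in> E"
  shows "branch v u = V - branch u v"
proof -
  have "branch u v \<inter> branch v u = {}"
  proof (rule ccontr)
    assume "\<not> ?thesis"
    then obtain w where w: "(v, w) \<in> (E - {(u, v), (v, u)})\<^sup>*" "(u, w) \<in> (E - {(u, v), (v, u)})\<^sup>*"
      by (auto simp: branch_def insert_commute)
    have "sym (E - {(u, v), (v, u)})"
      using E_sym by (auto simp: sym_def)
    then have "(w, u) \<in> (E - {(u, v), (v, u)})\<^sup>*"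
      using w(2) by (meson symD sym_rtrancl)
    then have "u \<in> branch u v"
      using w(1) by (auto simp: branch_def)
    then show False using not_in_branch[OF uv] by blast
  qed
  moreover have "w \<in> branch u v \<union> branch v u" if "w \<in> V" for w
  proof -
    obtain n where "(v, w) \<in> E ^^ n"
      using ex_walk[OF in_arcsD2[OF uv] \<open>w \<in> V\<close>] by blast
    then show ?thesis
    proof (induction n arbitrary: w)
      case 0
      then show ?case using branch_self by auto
    next
      case (Suc n)
      then obtain z where "(v, z) \<in> E ^^ n" "(z, w) \<in> E" by auto
      then show ?case
        using Suc.IH[of z] branch_exit[OF uv, of z w] branch_exit[OF E_sym[OF uv], of z w] branch_self
        by blast
    qed
  qed
  moreover have "branch v u \<subseteq> V"
    using branch_subset uv in_arcsD1 by blast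
  ultimately show ?thesis by blast
qed

lemma branch_child_subset:
  assumes "(u, v) \<in> E" "(v, z) \<in> E" "z \<noteq> u"
  shows "branch v z \<subseteq> branch u v - {v}"
proof
  fix w assume "w \<in> branch v z"
  then have "(z, w) \<in> (E - {(v, z), (z, v)})\<^sup>*" by (simp add: branch_def)
  then show "w \<in> branch u v - {v}"
  proof (induction rule: rtrancl_induct)
    case base
    then show ?case
      using branch_exit[OF assms(1,2) branch_self] assms E_irrefl by blast
  next
    case (step w w')
    then have "w' \<in> branch v z"
      unfolding branch_def by (auto intro: rtrancl_into_rtrancl)
    then have "w' \<noteq> v" using not_in_branch[OF assms(2)] by blast
    then show ?case
      using step branch_exit[OF assms(1), of w w'] by blast
  qed
qed

lemma branch_cover:
  assumes "(u, v) \<in> E" "w \<in> branch u v" "w \<noteq> v"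
  obtains z where "(v, z) \<in> E" "z \<noteq> u" "w \<in> branch v z"
proof -
  have "(v, w) \<in> (E - {(u, v), (v, u)})\<^sup>*"
    using assms(2) by (simp add: branch_def)
  then have "w = v \<or> (\<exists>z. (v, z) \<in> E \<and> z \<noteq> u \<and> w \<in> branch v z)"
  proof (induction rule: rtrancl_induct)
    case (step w w')
    then show ?case
      using branch_exit[of v _ w w'] branch_self by blast
  qed simp
  then show thesis using assms(3) that by blast
qed

lemma branch_cover_all:
  assumes "x \<in> V" "w \<in> V" "w \<noteq> x"
  obtains z where "(x, z) \<in> E" "w \<in> branch x z"
proof -
  obtain n where n: "(x, w) \<in> E ^^ n" using ex_walk[OF assms(1,2)] by blast
  then obtain p where p: "(x, p) \<in> E"
    using assms(3) by (metis relpow_E2)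
  show thesis
  proof (cases "w \<in> branch x p")
    case True
    then show thesis using p that by blast
  next
    case False
    then have "w \<in> branch p x" using branch_swap[OF p] assms by blast
    then show thesis using branch_cover[OF E_sym[OF p] _ assms(3)] that by blast
  qed
qed

lemma finite_branch: "(u, v) \<in> E \<Longrightarrow> finite (branch u v)"
  by (rule finite_subset[OF branch_subset finite_V]) (rule in_arcsD2)

lemma card_branch_child:
  assumes "(u, v) \<in> E" "(v, z) \<in> E" "z \<noteq> u"
  shows "card (branch v z) < card (branch u v)"
  using branch_child_subset[OF assms] branch_self[of v u] finite_branch[OF assms(1)]
  by (intro psubset_card_mono) auto

section \<open>Regions to which B is confined\<close>

definition fenced :: "'a set \<Rightarrow> 'a set \<Rightarrow> bool" where
  "fenced A S \<longleftrightarrow> (\<forall>u w. (u, w) \<in> E \<longrightarrow> u \<notin> S \<longrightarrow> w \<in> S \<longrightarrow> u \<in> A)"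

lemma fenced_branch: "(u, v) \<in> E \<Longrightarrow> u \<in> A \<Longrightarrow> fenced A (branch u v)"
  unfolding fenced_def using branch_entry[of u v] by auto

text \<open>Each B-vertex has its own fence, and \<open>v\<close> lies outside both. The later move
  is written first, in the order in which \<open>voronoi_value\<close> inserts the moves.\<close>

lemma fenced_setdist_less:
  assumes "fenced A S\<^sub>1" "fenced A S\<^sub>2" "b\<^sub>1 \<in> S\<^sub>1" "b\<^sub>2 \<in> S\<^sub>2" "b\<^sub>1 \<in> V" "b\<^sub>2 \<in> V"
    and "v \<in> V - (S\<^sub>1 \<union> S\<^sub>2)"
  shows "graph_setdist T v A < graph_setdist T v {b\<^sub>2, b\<^sub>1}"
proof (rule setdist_less)
  fix b assume "b \<in> {b\<^sub>2, b\<^sub>1}"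
  then show "\<exists>a\<in>A. graph_dist T v a < graph_dist T v b"
    using separated_closer[of v S\<^sub>1 b A] separated_closer[of v S\<^sub>2 b A] assms
    unfolding fenced_def by blast
qed auto

lemma fenced_share:
  assumes "fenced A S\<^sub>1" "fenced A S\<^sub>2" "b\<^sub>1 \<in> S\<^sub>1" "b\<^sub>2 \<in> S\<^sub>2" "b\<^sub>1 \<in> V" "b\<^sub>2 \<in> V"
    and sub: "S\<^sub>1 \<union> S\<^sub>2 \<subseteq> V" and small: "3 * card (S\<^sub>1 \<union> S\<^sub>2) < 2 * card V"
  shows "voronoi_share T A {b\<^sub>2, b\<^sub>1} > 1 / 3"
proof -
  have "real (card (V - (S\<^sub>1 \<union> S\<^sub>2))) + real (card ({} :: 'a set)) / 2
      \<le> voronoi_share T A {b\<^sub>2, b\<^sub>1} * real (card V)"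
    by (rule share_lower) (use fenced_setdist_less[OF assms(1-6)] in auto)
  moreover have "card (V - (S\<^sub>1 \<union> S\<^sub>2)) = card V - card (S\<^sub>1 \<union> S\<^sub>2)"
    using sub finite_subset[OF sub finite_V] by (intro card_Diff_subset)
  ultimately have "real (card V) < 3 * (voronoi_share T A {b\<^sub>2, b\<^sub>1} * real (card V))"
    using small by linarith
  then show ?thesis
    using V_nonempty finite_V by (simp add: card_gt_0_iff field_simps)
qed

section \<open>A's strategy in two rounds\<close>

lemma VR_2_gtI:
  assumes "4 \<le> card V" "x \<in> V"
    and reply: "\<And>b\<^sub>1. b\<^sub>1 \<in> V \<Longrightarrow> b\<^sub>1 \<noteq> x \<Longrightarrow> \<exists>a\<in>V - {x, b\<^sub>1}. \<forall>b\<^sub>2\<in>V - {a, x, b\<^sub>1}.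
      voronoi_share T {a, x} {b\<^sub>2, b\<^sub>1} > r"
  shows "VR T 2 > r"
proof -
  \<comment> \<open>Four vertices keep every minimum over replies of B nonempty.\<close>
  have free: "V - S \<noteq> {}" if "finite S" "card S < 4" for S
    using card_mono[OF that(1), of V] that(2) assms(1) by auto
  have card3: "card {u, v, w} < 4" for u v w :: 'a
    by (simp add: card_insert_if)
  have "voronoi_value T (Suc (Suc 0)) {} {} > r"
  proof (rule voronoi_value_Suc_gt[of x])
    show "V - (insert x {} \<union> {}) \<noteq> {}"
      using free[of "{x}"] by simp
    fix b\<^sub>1 assume b\<^sub>1: "b\<^sub>1 \<in> V - (insert x {} \<union> {})"
    then obtain a where a: "a \<in> V - {x, b\<^sub>1}"
      "\<forall>b\<^sub>2\<in>V - {a, x, b\<^sub>1}. voronoi_share T {a, x} {b\<^sub>2, b\<^sub>1} > r"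
      using reply[of b\<^sub>1] by auto
    show "voronoi_value T (Suc 0) (insert x {}) (insert b\<^sub>1 {}) > r"
    proof (rule voronoi_value_Suc_gt[of a])
      show "V - (insert a {x} \<union> {b\<^sub>1}) \<noteq> {}"
        using free[OF _ card3[of a x b\<^sub>1]] by (simp add: insert_commute)
    qed (use a in auto)
  qed (use assms(2) in auto)
  then show ?thesis by (simp add: VR_def numeral_2_eq_2)
qed

text \<open>The vertex \<open>x\<close> alone confines each B-vertex to one branch at
  \<open>x\<close>, hence to less than a third; the second move of A is arbitrary.\<close>

lemma VR_2_gt_one_centre:
  assumes "4 \<le> card V" "x \<in> V"
    and small: "\<And>z. (x, z) \<in> E \<Longrightarrow> 3 * card (branch x z) < card V"
  shows "VR T 2 > 1 / 3"
proof (rule VR_2_gtI[OF assms(1,2)])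
  fix b\<^sub>1 assume b\<^sub>1: "b\<^sub>1 \<in> V" "b\<^sub>1 \<noteq> x"
  have "V - {x, b\<^sub>1} \<noteq> {}"
    using card_mono[of "{x, b\<^sub>1}" V] assms(1) by (auto simp: card_insert_if split: if_splits)
  then obtain a where a: "a \<in> V - {x, b\<^sub>1}" by blast
  have "voronoi_share T {a, x} {b\<^sub>2, b\<^sub>1} > 1 / 3" if b\<^sub>2: "b\<^sub>2 \<in> V - {a, x, b\<^sub>1}" for b\<^sub>2
  proof -
    obtain z\<^sub>1 where z\<^sub>1: "(x, z\<^sub>1) \<in> E" "b\<^sub>1 \<in> branch x z\<^sub>1"
      using branch_cover_all[OF assms(2) b\<^sub>1] by blast
    obtain z\<^sub>2 where z\<^sub>2: "(x, z\<^sub>2) \<in> E" "b\<^sub>2 \<in> branch x z\<^sub>2"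
      using branch_cover_all[OF assms(2), of b\<^sub>2] b\<^sub>2 by blast
    show ?thesis
    proof (rule fenced_share[of _ "branch x z\<^sub>1" "branch x z\<^sub>2"])
      show "3 * card (branch x z\<^sub>1 \<union> branch x z\<^sub>2) < 2 * card V"
        using small[OF z\<^sub>1(1)] small[OF z\<^sub>2(1)] card_Un_le[of "branch x z\<^sub>1" "branch x z\<^sub>2"] by linarith
      show "branch x z\<^sub>1 \<union> branch x z\<^sub>2 \<subseteq> V"
        using branch_subset z\<^sub>1 z\<^sub>2 in_arcsD2 by (meson Un_least)
    qed (use z\<^sub>1 z\<^sub>2 b\<^sub>1 b\<^sub>2 fenced_branch in auto)
  qed
  then show "\<exists>a\<in>V - {x, b\<^sub>1}. \<forall>b\<^sub>2\<in>V - {a, x, b\<^sub>1}. 1 / 3 < voronoi_share T {a, x} {b\<^sub>2, b\<^sub>1}"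
    using a by blast
qed

text \<open>A opens at \<open>x\<close>. The hypothesis \<open>dom\<close> compares branch sizes
  lexicographically, with the sizes of the two big branches as tie-breaker, so that it can be met
  for one of the two orders of the centres.\<close>

lemma VR_2_gt_two_centres:
  assumes n: "4 \<le> card V" and px: "(p, x) \<in> E" and qy: "(q, y) \<in> E"
    and disj: "branch p x \<inter> branch q y = {}"
    and X: "card V \<le> 3 * card (branch p x)" and Y: "card V \<le> 3 * card (branch q y)"
    and x_small: "\<And>z. (x, z) \<in> E \<Longrightarrow> z \<noteq> p \<Longrightarrow> 3 * card (branch x z) < card V"
    and y_small: "\<And>z. (y, z) \<in> E \<Longrightarrow> z \<noteq> q \<Longrightarrow> 3 * card (branch y z) < card V"
    and z': "(y, z') \<in> E" "z' \<noteq> q"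
    and dom: "\<And>z. (x, z) \<in> E \<Longrightarrow> z \<noteq> p \<Longrightarrow> card (branch x z) < card (branch y z') \<or>
      card (branch x z) = card (branch y z') \<and> card (branch q y) \<le> card (branch p x)"
  shows "VR T 2 > 1 / 3"
proof -
  define X where "X = branch p x"
  define Y where "Y = branch q y"
  define M where "M = V - (X \<union> Y)"
  have V: "p \<in> V" "x \<in> V" "q \<in> V" "y \<in> V" "z' \<in> V"
    using px qy z' in_arcsD1 in_arcsD2 by blast+
  have XY: "X \<subseteq> V" "Y \<subseteq> V" "x \<in> X" "y \<in> Y" "p \<notin> X" "q \<notin> Y"
    using branch_subset V branch_self not_in_branch px qy unfolding X_def Y_def by auto
  have xy: "x \<noteq> y" "x \<notin> Y" "y \<notin> X" using disj XY unfolding X_def Y_def by auto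
  have cardV: "card V = card X + card Y + card M"
  proof -
    have fin: "finite X" "finite Y" "finite M"
      using finite_branch[OF px] finite_branch[OF qy] finite_V by (auto simp: X_def Y_def M_def)
    have "V = (X \<union> Y) \<union> M" using XY by (auto simp: M_def)
    then have "card V = card (X \<union> Y) + card M"
      using fin by (metis M_def Diff_disjoint card_Un_disjoint finite_Un)
    then show ?thesis
      using disj fin card_Un_disjoint[of X Y] by (simp add: X_def Y_def)
  qed
  have M_small: "3 * card M \<le> card V"
    using cardV X Y unfolding X_def Y_def by linarith
  have M_fence: "u = x \<or> u = y" if "(u, w) \<in> E" "u \<notin> M" "w \<in> M" for u w
  proof -
    have "u \<in> X \<or> u \<in> Y" using that in_arcsD1 by (auto simp: M_def)
    then show ?thesis
      using branch_exit[OF px that(1)] branch_exit[OF qy that(1)] that(3)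
      by (auto simp: X_def Y_def M_def)
  qed
  show ?thesis
  proof (rule VR_2_gtI[OF n V(2)])
    fix b\<^sub>1 assume b\<^sub>1: "b\<^sub>1 \<in> V" "b\<^sub>1 \<noteq> x"
    show "\<exists>a\<in>V - {x, b\<^sub>1}. \<forall>b\<^sub>2\<in>V - {a, x, b\<^sub>1}. 1 / 3 < voronoi_share T {a, x} {b\<^sub>2, b\<^sub>1}"
    proof (cases "b\<^sub>1 = y")
      case False
      \<comment> \<open>With \<open>x\<close> and \<open>y\<close> both held by A, every other
        vertex lies in a branch hanging off one of them or in the middle piece \<open>M\<close>, and
        each of these is fenced.\<close>
      have piece: "\<exists>S. b \<in> S \<and> S \<subseteq> V \<and> fenced {y, x} S \<and> (S = M \<or> 3 * card S < card V)"
        if b: "b \<in> V" "b \<noteq> x" "b \<noteq> y" for b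
      proof -
        consider "b \<in> X" | "b \<in> Y" | "b \<in> M" using b by (auto simp: M_def)
        then show ?thesis
        proof cases
          case 1
          then obtain z where "(x, z) \<in> E" "z \<noteq> p" "b \<in> branch x z"
            using branch_cover[OF px] b unfolding X_def by blast
          then show ?thesis
            using x_small[of z] fenced_branch[of x z "{y, x}"] branch_subset[OF in_arcsD2] by blast
        next
          case 2
          then obtain z where "(y, z) \<in> E" "z \<noteq> q" "b \<in> branch y z"
            using branch_cover[OF qy] b unfolding Y_def by blast
          then show ?thesis
            using y_small[of z] fenced_branch[of y z "{y, x}"] branch_subset[OF in_arcsD2] by blast
        next
          case 3
          moreover have "fenced {y, x} M" using M_fence unfolding fenced_def by blast
          moreover have "M \<subseteq> V" by (auto simp: M_def)
          ultimately show ?thesis by blast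
        qed
      qed
      have "voronoi_share T {y, x} {b\<^sub>2, b\<^sub>1} > 1 / 3" if b\<^sub>2: "b\<^sub>2 \<in> V - {y, x, b\<^sub>1}" for b\<^sub>2
      proof -
        obtain S\<^sub>1 where S\<^sub>1: "b\<^sub>1 \<in> S\<^sub>1" "S\<^sub>1 \<subseteq> V" "fenced {y, x} S\<^sub>1" "S\<^sub>1 = M \<or> 3 * card S\<^sub>1 < card V"
          using piece[of b\<^sub>1] b\<^sub>1 False by blast
        obtain S\<^sub>2 where S\<^sub>2: "b\<^sub>2 \<in> S\<^sub>2" "S\<^sub>2 \<subseteq> V" "fenced {y, x} S\<^sub>2" "S\<^sub>2 = M \<or> 3 * card S\<^sub>2 < card V"
          using piece[of b\<^sub>2] b\<^sub>2 by blast
        show ?thesis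
        proof (rule fenced_share[of _ S\<^sub>1 S\<^sub>2])
          show "3 * card (S\<^sub>1 \<union> S\<^sub>2) < 2 * card V"
          \<comment> \<open>Only \<open>M\<close> may reach a third exactly. If both B-vertices are
            in \<open>M\<close>, it is counted once; otherwise one of the two pieces is strictly
            smaller than a third.\<close>
          proof (cases "S\<^sub>1 = M \<and> S\<^sub>2 = M")
            case True
            then show ?thesis using M_small n by simp
          next
            case False
            then show ?thesis
              using S\<^sub>1(4) S\<^sub>2(4) M_small card_Un_le[of S\<^sub>1 S\<^sub>2] by auto
          qed
        qed (use S\<^sub>1 S\<^sub>2 b\<^sub>1 b\<^sub>2 in auto)
      qed
      then show ?thesis using V(4) xy False by blast
    next
      case True
      have z'Y: "branch y z' \<subseteq> Y - {y}"
        using branch_child_subset[OF qy z'] by (simp add: Y_def)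
      then have z'_in: "z' \<in> Y" "z' \<noteq> y" using branch_self by auto
      have z'_new: "z' \<noteq> x" using z'_in xy by blast
      have pos: "card V > 0" using n by simp
      have "voronoi_share T {z', x} {b\<^sub>2, y} > 1 / 3" if b\<^sub>2: "b\<^sub>2 \<in> V - {z', x, y}" for b\<^sub>2
      proof (cases "b\<^sub>2 \<in> X")
        case False
        have compl: "branch x p = V - X" using branch_swap[OF px] by (simp add: X_def)
        have fence: "fenced {z', x} (V - X)"
          using fenced_branch[OF E_sym[OF px], of "{z', x}"] compl by simp
        \<comment> \<open>B has stayed outside \<open>X\<close>, so \<open>x\<close> guards all of
          \<open>X\<close>. The vertex \<open>z'\<close>, owned by A anyway, supplies the strict
          inequality.\<close>
        have win: "graph_setdist T v {z', x} < graph_setdist T v {b\<^sub>2, y}" if "v \<in> insert z' X" for v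
        proof (cases "v \<in> X")
          case True
          then show ?thesis
            using fenced_setdist_less[OF fence fence, of y b\<^sub>2 v] xy V b\<^sub>2 \<open>b\<^sub>2 \<notin> X\<close> XY by auto
        next
          case False
          then have "v = z'" using that by blast
          show ?thesis
          proof (rule setdist_less)
            fix b assume "b \<in> {b\<^sub>2, y}"
            then have "b \<in> V" "z' \<noteq> b" using V b\<^sub>2 z'_in by auto
            then have "graph_dist T z' z' < graph_dist T z' b"
              by (rule graph_dist_self_less[OF V(5)])
            then show "\<exists>a\<in>{z', x}. graph_dist T v a < graph_dist T v b"
              using \<open>v = z'\<close> by blast
          qed auto
        qed
        have "real (card (insert z' X)) + real (card ({} :: 'a set)) / 2
            \<le> voronoi_share T {z', x} {b\<^sub>2, y} * real (card V)"
          by (rule share_lower) (use win XY V in auto)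
        moreover have "card (insert z' X) = Suc (card X)"
          using z'_in disj finite_branch[OF px] by (subst card_insert_disjoint) (auto simp: X_def Y_def)
        ultimately have "real (card V) < 3 * (voronoi_share T {z', x} {b\<^sub>2, y} * real (card V))"
          using X unfolding X_def by simp
        then show ?thesis using pos by (simp add: field_simps)
      next
        case True
        then obtain z where z: "(x, z) \<in> E" "z \<noteq> p" "b\<^sub>2 \<in> branch x z"
          using branch_cover[OF px] b\<^sub>2 unfolding X_def by blast
        have zX: "branch x z \<subseteq> X - {x}"
          using branch_child_subset[OF px z(1,2)] by (simp add: X_def)
        define S where "S = V - (X \<union> branch y z')"
        have fence1: "fenced {z', x} S"
          unfolding fenced_def
        proof (intro allI impI)
          fix u w assume uw: "(u, w) \<in> E" "u \<notin> S" "w \<in> S"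
          then have "u \<in> X \<or> u \<in> branch y z'" using in_arcsD1 by (auto simp: S_def)
          then show "u \<in> {z', x}"
            using branch_exit[OF px uw(1)] branch_exit[OF z'(1) uw(1)] uw(3)
            by (auto simp: X_def S_def)
        qed
        have fence2: "fenced {z', x} (branch x z)"
          by (rule fenced_branch[OF z(1)]) simp
        \<comment> \<open>A loses the branch of \<open>X\<close> that contains
          \<open>b\<^sub>2\<close> and wins the branch of \<open>Y\<close> below \<open>z'\<close>.
          If \<open>M\<close> is nonempty, then \<open>p\<close> lies in it, is adjacent to
          \<open>x\<close> and is not taken by B, hence is at worst tied and adds one half.\<close>
        define W where "W = (X - branch x z) \<union> branch y z'"
        define P where "P = (if M = {} then {} else {p})"
        have W: "W \<subseteq> V - (S \<union> branch x z)"
          using XY z'Y zX disj by (auto simp: W_def S_def X_def Y_def)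
        have P_M: "P \<subseteq> M"
        proof -
          \<comment> \<open>Otherwise \<open>p\<close> is in \<open>Y\<close>, and the edge to
            \<open>x\<close> leaves \<open>Y\<close>; it must be the edge defining \<open>Y\<close>,
            so \<open>Y\<close> is the complement of \<open>X\<close> and \<open>M\<close> is
            empty.\<close>
          have "p \<in> M" if "M \<noteq> {}"
          proof (rule ccontr)
            assume "p \<notin> M"
            then have "p \<in> Y" using XY V by (auto simp: M_def)
            then have "p = y" "x = q"
              using branch_exit[OF qy E_sym[OF E_sym[OF px]]] xy by (auto simp: Y_def)
            then have "Y = V - X"
              using branch_swap[OF px] by (simp add: X_def Y_def)
            then show False using that by (auto simp: M_def)
          qed
          then show ?thesis by (auto simp: P_def)
        qed
        have "real (card W) + real (card P) / 2 \<le> voronoi_share T {z', x} {b\<^sub>2, y} * real (card V)"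
        proof (rule share_lower)
          show "graph_setdist T v {z', x} < graph_setdist T v {b\<^sub>2, y}" if "v \<in> W" for v
            using fenced_setdist_less[OF fence1 fence2, of y b\<^sub>2 v] W that z V b\<^sub>2 xy z'Y
            by (auto simp: S_def)
          show "graph_setdist T v {z', x} \<le> graph_setdist T v {b\<^sub>2, y}" if "v \<in> P" for v
          proof -
            have v: "v = p" "p \<in> M" using that P_M by (auto simp: P_def split: if_splits)
            have "graph_setdist T p {z', x} \<le> graph_dist T p x"
              unfolding graph_setdist_def by (rule INF_lower) simp
            also have "\<dots> \<le> 1"
              using graph_dist_le[OF V(1), of x 1] px by (simp add: one_ereal_def)
            also have "1 \<le> graph_setdist T p {b\<^sub>2, y}"
              unfolding graph_setdist_def
            proof (rule INF_greatest)
              fix b assume "b \<in> {b\<^sub>2, y}"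
              then have "b \<in> V" "p \<noteq> b"
                using v XY V b\<^sub>2 True by (auto simp: M_def)
              then show "1 \<le> graph_dist T p b" by (rule graph_dist_neq_ge_1[OF V(1)])
            qed
            finally show ?thesis using v by simp
          qed
          show "W \<inter> P = {}" using P_M z'Y by (auto simp: W_def M_def)
        qed (use W P_M in \<open>auto simp: M_def\<close>)
        \<comment> \<open>If the branch at \<open>z'\<close> is strictly larger, \<open>W\<close>
          has more vertices than \<open>X\<close>, which holds at least a third. In a tie, either
          \<open>M\<close> is nonempty and the half vertex decides, or \<open>M\<close> is empty and
          \<open>X\<close>, no smaller than \<open>Y\<close>, holds at least half of the
          tree.\<close>
        moreover have "2 * card V < 6 * card W + 3 * card P"
        proof -
          have "card W = (card X - card (branch x z)) + card (branch y z')"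
          proof -
            have fin: "finite X" "finite (branch x z)" "finite (branch y z')"
              using finite_branch px z z' by (auto simp: X_def)
            have "card W = card (X - branch x z) + card (branch y z')"
              unfolding W_def using fin z'Y disj by (intro card_Un_disjoint) (auto simp: X_def Y_def)
            then show ?thesis
              using card_Diff_subset[OF fin(2), of X] zX by auto
          qed
          moreover have "card (branch x z) \<le> card X"
            using card_branch_child[OF px z(1,2)] by (simp add: X_def)
          moreover have "card P = (if M = {} then 0 else 1)" by (simp add: P_def)
          moreover have "card M = 0 \<longleftrightarrow> M = {}" using finite_V by (simp add: M_def)
          ultimately show ?thesis
            using dom[OF z(1,2)] X Y cardV pos unfolding X_def[symmetric] Y_def[symmetric]
            by (cases "M = {}") auto
        qed
        ultimately have "real (card V) < 3 * (voronoi_share T {z', x} {b\<^sub>2, y} * real (card V))"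
          by linarith
        then show ?thesis using pos by (simp add: field_simps)
      qed
      then show ?thesis using V(5) z'_new z'_in True by blast
    qed
  qed
qed

theorem VR_2_gt:
  assumes n: "4 \<le> card V"
  shows "VR T 2 > 1 / 3"
proof -
  \<comment> \<open>The two sides of any edge partition the vertices, so one side holds at least
    half.\<close>
  have ex_edge: "\<exists>e. e \<in> E \<and> card V \<le> 3 * card (case_prod branch e)"
  proof -
    have "\<not> card V \<le> Suc 0" using n by simp
    then obtain u w where uw: "u \<in> V" "w \<in> V" "w \<noteq> u"
      using finite_V card_le_Suc0_iff_eq by metis
    obtain v where uv: "(u, v) \<in> E"
      using branch_cover_all[OF uw] by blast
    have "card (branch v u) = card V - card (branch u v)"
      using branch_swap[OF uv] branch_subset[OF in_arcsD2[OF uv]] finite_branch[OF uv]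
      by (simp add: card_Diff_subset)
    then have "card V \<le> 3 * card (branch u v) \<or> card V \<le> 3 * card (branch v u)"
      by linarith
    then show ?thesis using uv E_sym[OF uv] by fastforce
  qed
  then obtain e where e: "e \<in> E \<and> card V \<le> 3 * card (case_prod branch e)"
    "\<And>e'. e' \<in> E \<and> card V \<le> 3 * card (case_prod branch e')
      \<Longrightarrow> card (case_prod branch e) \<le> card (case_prod branch e')"
    using ex_has_least_nat[of "\<lambda>e. e \<in> E \<and> card V \<le> 3 * card (case_prod branch e)" _
        "\<lambda>e. card (case_prod branch e)"] by blast
  obtain p x where px_eq: "e = (p, x)" by (cases e)
  have px: "(p, x) \<in> E" and X: "card V \<le> 3 * card (branch p x)"
    using e(1) px_eq by auto
  have x_small: "3 * card (branch x z) < card V" if z: "(x, z) \<in> E" "z \<noteq> p" for z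
    using e(2)[of "(x, z)"] card_branch_child[OF px z] z px_eq by force
  have "x \<in> V" using px in_arcsD2 by blast
  have swap: "branch x p = V - branch p x" by (rule branch_swap[OF px])
  show ?thesis
  proof (cases "3 * card (branch x p) < card V")
    case True
    show ?thesis
      by (rule VR_2_gt_one_centre[OF n \<open>x \<in> V\<close>]) (use True x_small in metis)
  next
    case False
    \<comment> \<open>The whole complement of the first branch is a candidate. Child branches of the
      minimal candidate stay disjoint from the first branch, so minimality makes them smaller than a
      third.\<close>
    let ?P = "\<lambda>e. e \<in> E \<and> card V \<le> 3 * card (case_prod branch e) \<and> case_prod branch e \<inter> branch p x = {}"
    have "?P (x, p)" using False swap E_sym[OF px] by auto
    from ex_has_least_nat[of ?P, OF this, of "\<lambda>e. card (case_prod branch e)"]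
    obtain e' where e': "?P e'"
      "\<forall>e''. ?P e'' \<longrightarrow> card (case_prod branch e') \<le> card (case_prod branch e'')"
      by (elim exE) (rule that, (erule conjunct1, erule conjunct2))
    obtain q y where qy_eq: "e' = (q, y)" by (cases e')
    have qy: "(q, y) \<in> E" and Y: "card V \<le> 3 * card (branch q y)"
      and disj: "branch q y \<inter> branch p x = {}"
      using e'(1) qy_eq by auto
    have y_small: "3 * card (branch y z) < card V" if z: "(y, z) \<in> E" "z \<noteq> q" for z
      using e'(2)[rule_format, of "(y, z)"] card_branch_child[OF qy z] branch_child_subset[OF qy z] disj z qy_eq
      by force
    \<comment> \<open>Since there are at least 4 vertices, a branch with at least a third of them is
      more than its root, so the root has a child.\<close>
    have largest: "\<exists>z. ((v, z) \<in> E \<and> z \<noteq> u) \<and>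
        (\<forall>z'. (v, z') \<in> E \<and> z' \<noteq> u \<longrightarrow> card (branch v z') \<le> card (branch v z))"
      if uv: "(u, v) \<in> E" and "card V \<le> 3 * card (branch u v)" for u v
    proof -
      have "branch u v \<noteq> {v}" using that(2) n by auto
      then obtain w where "w \<in> branch u v" "w \<noteq> v" using branch_self[of v u] by blast
      then obtain z where "(v, z) \<in> E \<and> z \<noteq> u" using branch_cover[OF uv] by metis
      then show ?thesis
        using ex_has_greatest_nat[of "\<lambda>z. (v, z) \<in> E \<and> z \<noteq> u" z "\<lambda>z. card (branch v z)"
            "card (branch u v)"] card_branch_child[OF uv] by (meson less_imp_le)
    qed
    obtain z\<^sub>x where z\<^sub>x: "(x, z\<^sub>x) \<in> E" "z\<^sub>x \<noteq> p"
      "\<And>z. (x, z) \<in> E \<Longrightarrow> z \<noteq> p \<Longrightarrow> card (branch x z) \<le> card (branch x z\<^sub>x)"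
      using largest[OF px X] by blast
    obtain z\<^sub>y where z\<^sub>y: "(y, z\<^sub>y) \<in> E" "z\<^sub>y \<noteq> q"
      "\<And>z. (y, z) \<in> E \<Longrightarrow> z \<noteq> q \<Longrightarrow> card (branch y z) \<le> card (branch y z\<^sub>y)"
      using largest[OF qy Y] by blast
    show ?thesis
    proof (cases "card (branch x z\<^sub>x) < card (branch y z\<^sub>y) \<or>
        card (branch x z\<^sub>x) = card (branch y z\<^sub>y) \<and> card (branch q y) \<le> card (branch p x)")
      case True
      have "card (branch x z) < card (branch y z\<^sub>y) \<or>
          card (branch x z) = card (branch y z\<^sub>y) \<and> card (branch q y) \<le> card (branch p x)"
        if "(x, z) \<in> E" "z \<noteq> p" for z
        using z\<^sub>x(3)[OF that] True by linarith
      moreover have "branch p x \<inter> branch q y = {}" using disj by blast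
      ultimately show ?thesis
        using VR_2_gt_two_centres[OF n px qy _ X Y x_small y_small z\<^sub>y(1,2)] by blast
    next
      case False
      have "card (branch y z) < card (branch x z\<^sub>x) \<or>
          card (branch y z) = card (branch x z\<^sub>x) \<and> card (branch p x) \<le> card (branch q y)"
        if "(y, z) \<in> E" "z \<noteq> q" for z
        using z\<^sub>y(3)[OF that] False by linarith
      then show ?thesis
        using VR_2_gt_two_centres[OF n qy px disj Y X y_small x_small z\<^sub>x(1,2)] by blast
    qed
  qed
qed

end

section \<open>Trees given by a parent function\<close>

definition parent_rel :: "('a \<Rightarrow> 'a) \<Rightarrow> 'a \<Rightarrow> 'a set \<Rightarrow> 'a rel" where
  "parent_rel par r V = {(v, par v) | v. v \<in> V - {r}}"

definition parent_graph :: "('a \<Rightarrow> 'a) \<Rightarrow> 'a \<Rightarrow> 'a set \<Rightarrow> 'a pair_pre_digraph" where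
  "parent_graph par r V = \<lparr>pverts = V, parcs = parent_rel par r V \<union> (parent_rel par r V)\<inverse>\<rparr>"

lemma last_in_pawalk_verts: "pcas u p v \<Longrightarrow> v \<in> set (pawalk_verts u p)"
  by (induction p arbitrary: u) auto

lemma pawalk_arc_ends: "pcas u p v \<Longrightarrow> e \<in> set p \<Longrightarrow> fst e \<in> set (pawalk_verts u p)"
  by (induction p arbitrary: u) auto

lemma pawalk_no_arc_from_last:
  "pcas u p v \<Longrightarrow> distinct (pawalk_verts u p) \<Longrightarrow> e \<in> set p \<Longrightarrow> fst e \<noteq> v"
  by (induction p arbitrary: u) (auto dest: last_in_pawalk_verts)

lemma pawalk_direct_arc:
  assumes "pcas u p v" "distinct (pawalk_verts u p)" "(u, v) \<in> set p"
  shows "length p = 1"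
proof (cases p)
  case (Cons e es)
  then have "(u, v) \<notin> set es"
    using assms pawalk_arc_ends[of "snd e" es v "(u, v)"] by auto
  then have "pcas v es v" "distinct (pawalk_verts v es)" using assms Cons by auto
  then have "es = []"
    using pawalk_no_arc_from_last[of v es v "hd es"] by (cases es) auto
  then show ?thesis using Cons by simp
qed (use assms in simp)

lemma pcas_crossing:
  "pcas u p v \<Longrightarrow> (u \<in> S) \<noteq> (v \<in> S) \<Longrightarrow> \<exists>(a, b)\<in>set p. (a \<in> S) \<noteq> (b \<in> S)"
  by (induction p arbitrary: u) force+

text \<open>Parents have smaller \<open>h\<close>, so every vertex reaches \<open>r\<close>. The
  edge from \<open>v\<close> to its parent is the only one between the descendants of
  \<open>v\<close> and the rest, so a closed walk cannot leave over it and return by another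
  edge.\<close>

lemma simple_tree_parent_graph:
  fixes h :: "'a \<Rightarrow> nat"
  assumes fin: "finite V" and "r \<in> V"
    and par: "\<And>v. v \<in> V \<Longrightarrow> v \<noteq> r \<Longrightarrow> par v \<in> V \<and> h (par v) < h v"
  shows "simple_tree (parent_graph par r V)"
proof -
  define R where "R = parent_rel par r V"
  define G where "G = parent_graph par r V"
  have R_iff: "(u, v) \<in> R \<longleftrightarrow> u \<in> V \<and> u \<noteq> r \<and> v = par u" for u v
    by (auto simp: R_def parent_rel_def)
  have G: "pverts G = V" "parcs G = R \<union> R\<inverse>"
    by (simp_all add: G_def parent_graph_def R_def)
  have "R \<subseteq> V \<times> V" using par by (auto simp: R_iff)
  then have "finite R" using fin finite_subset by blast
  have par_neq: "par v \<noteq> v" if "v \<in> V" "v \<noteq> r" for v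
    using par[OF that] by auto
  interpret G: pair_graph G
  proof
    show "finite (parcs G)" using \<open>finite R\<close> G by simp
    show "symmetric (with_proj G)" using G by (auto simp: symmetric_def sym_def)
    show "fst e \<noteq> snd e" if "e \<in> parcs G" for e
      using that par_neq G by (cases e) (metis R_iff Un_iff converse_iff fst_conv snd_conv)
  qed (use par fin G in \<open>auto simp: R_iff\<close>)
  have to_root: "v \<rightarrow>\<^sup>*\<^bsub>with_proj G\<^esub> r" if "v \<in> V" for v
    using that
  proof (induction "h v" arbitrary: v rule: less_induct)
    case less
    show ?case
    proof (cases "v = r")
      case True
      then show ?thesis using less.prems G by auto
    next
      case False
      then have "par v \<rightarrow>\<^sup>*\<^bsub>with_proj G\<^esub> r" using less par by blast
      moreover have "(v, par v) \<in> parcs G" using False less.prems G by (simp add: R_iff)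
      ultimately show ?thesis by (meson G.adj_reachable_trans)
    qed
  qed
  have "Digraph_Component.connected (with_proj G)"
  proof (rule G.connectedI)
    show "u \<rightarrow>\<^sup>*\<^bsub>with_proj (mk_symmetric (with_proj G))\<^esub> v" if "u \<in> pverts G" "v \<in> pverts G" for u v
      using to_root[of u] to_root[of v] that G
      by (meson G.reachable_mk_symmetricI G.reachable_trans G.symmetric_reachable')
  qed (use \<open>r \<in> V\<close> G in auto)
  moreover have "False" if c: "G.cycle c" "3 \<le> length c" for c
  proof -
    obtain u where u: "G.awalk u c u" "distinct (tl (pawalk_verts u c))"
      using c(1) by (auto simp: G.cycle_def)
    then obtain w p where c_eq: "c = (u, w) # p" and p: "pcas w p u" "distinct (pawalk_verts w p)"
      and sub: "set p \<subseteq> parcs G" and uw: "(u, w) \<in> parcs G"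
      using c(2) by (cases c) (auto simp: G.awalk_def)
    \<comment> \<open>The path \<open>p\<close> ends at \<open>u\<close> without repeating it, so no
      arc of \<open>p\<close> starts there; the reverse arc would be all of \<open>p\<close> and
      make the cycle of length 2.\<close>
    have avoid: "(u, w) \<notin> set p" "(w, u) \<notin> set p"
      using pawalk_no_arc_from_last[OF p, of "(u, w)"] pawalk_direct_arc[OF p] c(2) c_eq by auto
    obtain v where v: "v \<in> V" "v \<noteq> r" "{u, w} = {v, par v}"
      using uw G by (auto simp: R_iff)
    define D where "D = {x. (x, v) \<in> R\<^sup>*}"
    have D_exit: "a = v \<and> b = par v" if "(a, b) \<in> parcs G" "a \<in> D" "b \<notin> D" for a b
    proof -
      have "(b, a) \<notin> R" using that by (auto simp: D_def intro: converse_rtrancl_into_rtrancl)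
      then have ab: "(a, b) \<in> R" using that G by auto
      have "a = v"
        using \<open>a \<in> D\<close> unfolding D_def mem_Collect_eq
      proof (cases rule: converse_rtranclE)
        case (step y)
        then show ?thesis using ab that(3) by (simp add: R_iff D_def)
      qed
      then show ?thesis using ab by (simp add: R_iff)
    qed
    have "h v \<le> h x" if "(x, v) \<in> R\<^sup>*" for x
      using that by (induction rule: converse_rtrancl_induct) (use par in \<open>force simp: R_iff\<close>)+
    then have "par v \<notin> D" using par[OF v(1,2)] by (force simp: D_def)
    moreover have "v \<in> D" by (simp add: D_def)
    ultimately have "(w \<in> D) \<noteq> (u \<in> D)" using v(3) by (metis doubleton_eq_iff)
    then obtain a b where ab: "(a, b) \<in> set p" "(a \<in> D) \<noteq> (b \<in> D)"
      using pcas_crossing[OF p(1), of D] by blast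
    then have "(a, b) \<in> parcs G" "(b, a) \<in> parcs G" using sub G.arcs_symmetric by auto
    then have "{a, b} = {v, par v}" using D_exit[of a b] D_exit[of b a] ab(2) by auto
    then have "(a, b) = (u, w) \<or> (a, b) = (w, u)" using v(3) by (metis doubleton_eq_iff)
    then show False using ab(1) avoid by auto
  qed
  ultimately show ?thesis
    unfolding G_def[symmetric] simple_tree_def using G.pair_graph by blast
qed

section \<open>The upper bound\<close>

text \<open>A strategy of B in the form of an invariant: after every move of A some answer restores
  it, and at the end it bounds the share.\<close>

lemma (in finite_tree) voronoi_value_le_invariant:
  assumes step: "\<And>s A B a. Inv (Suc s) A B \<Longrightarrow> a \<in> V - (A \<union> B) \<Longrightarrow>
      \<exists>b\<in>V - (insert a A \<union> B). Inv s (insert a A) (insert b B)"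
    and free: "\<And>s A B. Inv (Suc s) A B \<Longrightarrow> V - (A \<union> B) \<noteq> {}"
    and final: "\<And>A B. Inv 0 A B \<Longrightarrow> voronoi_share T A B \<le> r"
  shows "Inv s A B \<Longrightarrow> voronoi_value T s A B \<le> r"
proof (induction s arbitrary: A B)
  case 0
  then show ?case using final by simp
next
  case (Suc s)
  show ?case
    by (rule voronoi_value_Suc_le[OF free[OF Suc.prems]]) (use step[OF Suc.prems] Suc.IH in blast)
qed

text \<open>
  A vertex of the example is coded as \<open>vx j y l\<close>: it belongs to part \<open>j\<close> (the two legs are 0 and 1,
  the star is 2) at distance \<open>y\<close> along the spine, and is the spine vertex itself if \<open>l = 0\<close> and its
  \<open>l\<close>-th leaf otherwise. The centre is \<open>vx 0 0 0\<close>.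
\<close>

definition vx :: "nat \<Rightarrow> nat \<Rightarrow> nat \<Rightarrow> nat" where
  "vx j y l = prod_encode (j, prod_encode (y, l))"

definition part :: "nat \<Rightarrow> nat" where
  "part v = fst (prod_decode v)"

definition pos :: "nat \<Rightarrow> nat" where
  "pos v = fst (prod_decode (snd (prod_decode v)))"

definition leaf :: "nat \<Rightarrow> nat" where
  "leaf v = snd (prod_decode (snd (prod_decode v)))"

lemma vx_simps [simp]: "part (vx j y l) = j" "pos (vx j y l) = y" "leaf (vx j y l) = l"
  by (simp_all add: vx_def part_def pos_def leaf_def)

lemma vx_collapse [simp]: "vx (part v) (pos v) (leaf v) = v"
  by (simp add: vx_def part_def pos_def leaf_def)

lemma vx_eq_iff: "vx j y l = v \<longleftrightarrow> part v = j \<and> pos v = y \<and> leaf v = l"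
  using vx_collapse[of v] by auto

text \<open>Each leg has a spine of length \<open>4 ^ k\<close> and \<open>k\<close> bunches of
  \<open>M\<close> leaves; the star has \<open>k * M\<close> leaves, so the three parts have equally
  many. The game lasts \<open>t\<close> rounds.\<close>

locale spider =
  fixes k M t :: nat
  assumes t_less: "t < k" and M_ge: "2 \<le> M"
begin

definition c :: nat where "c = vx 0 0 0"
definition h :: nat where "h = vx 2 1 0"

definition sverts :: "nat set" where
  "sverts = {v. v = c
     \<or> part v < 2 \<and> 1 \<le> pos v \<and> pos v \<le> 4 ^ k \<and> leaf v = 0
     \<or> part v < 2 \<and> (\<exists>i<k. pos v = 4 ^ i) \<and> 1 \<le> leaf v \<and> leaf v \<le> M
     \<or> part v = 2 \<and> pos v = 1 \<and> leaf v \<le> k * M}"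

definition par :: "nat \<Rightarrow> nat" where
  "par v = (if 0 < leaf v then vx (part v) (pos v) 0
            else if 1 < pos v then vx (part v) (pos v - 1) 0 else c)"

text \<open>The depth below \<open>c\<close>: a leaf is one edge further than its spine
  vertex.\<close>

definition height :: "nat \<Rightarrow> nat" where
  "height v = pos v + (if 0 < leaf v then 1 else 0)"

definition T :: "nat pair_pre_digraph" where
  "T = parent_graph par c sverts"

lemma c_simps [simp]: "part c = 0" "pos c = 0" "leaf c = 0"
  by (simp_all add: c_def)

lemma h_simps [simp]: "part h = 2" "pos h = 1" "leaf h = 0"
  by (simp_all add: h_def)

lemma eq_c_iff: "v = c \<longleftrightarrow> part v = 0 \<and> pos v = 0 \<and> leaf v = 0"
  using vx_eq_iff[of 0 0 0 v] by (auto simp: c_def)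

lemma pos_verts:
  assumes "v \<in> sverts"
  shows "pos v = 0 \<longleftrightarrow> v = c" "pos v \<le> 4 ^ k" "part v \<le> 2"
proof -
  have "4 ^ i \<le> (4 :: nat) ^ k" if "i < k" for i
    using that by (intro power_increasing) auto
  then show "pos v = 0 \<longleftrightarrow> v = c" "pos v \<le> 4 ^ k" "part v \<le> 2"
    using assms by (auto simp: sverts_def)
qed

lemma spine_in_verts: "j < 2 \<Longrightarrow> 1 \<le> y \<Longrightarrow> y \<le> 4 ^ k \<Longrightarrow> vx j y 0 \<in> sverts"
  by (simp add: sverts_def)

lemma c_h_in_verts: "c \<in> sverts" "h \<in> sverts"
  by (simp_all add: sverts_def)

lemma par_in_verts:
  assumes "v \<in> sverts" "v \<noteq> c"
  shows "par v \<in> sverts" "height (par v) = height v - 1" "0 < height v"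
proof -
  have "0 < pos v" using pos_verts(1)[OF assms(1)] assms(2) by simp
  then show "height (par v) = height v - 1" "0 < height v"
    by (auto simp: par_def height_def)
  show "par v \<in> sverts"
    using assms pos_verts[OF assms(1)] \<open>0 < pos v\<close> by (auto simp: par_def sverts_def)
qed

lemma verts_subset_images:
  "sverts \<subseteq> {c} \<union> (\<lambda>(j, y). vx j y 0) ` ({..<2} \<times> {1..4 ^ k})
     \<union> (\<lambda>(j, i, l). vx j (4 ^ i) l) ` ({..<2} \<times> {..<k} \<times> {1..M})
     \<union> vx 2 1 ` {..k * M}" (is "_ \<subseteq> _ \<union> ?A \<union> ?B \<union> ?C")
proof
  fix v assume "v \<in> sverts"
  then consider "v = c" | "part v < 2" "1 \<le> pos v" "pos v \<le> 4 ^ k" "leaf v = 0"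
    | i where "part v < 2" "i < k" "pos v = 4 ^ i" "1 \<le> leaf v" "leaf v \<le> M"
    | "part v = 2" "pos v = 1" "leaf v \<le> k * M"
    by (auto simp: sverts_def)
  then show "v \<in> {c} \<union> ?A \<union> ?B \<union> ?C"
  proof cases
    case 2
    then have "v \<in> ?A"
      by (intro image_eqI[of _ _ "(part v, pos v)"]) (auto simp: vx_eq_iff eq_commute[of v])
    then show ?thesis by blast
  next
    case (3 i)
    then have "v \<in> ?B"
      by (intro image_eqI[of _ _ "(part v, i, leaf v)"]) (auto simp: vx_eq_iff eq_commute[of v])
    then show ?thesis by blast
  next
    case 4
    then have "v \<in> ?C"
      by (intro image_eqI[of _ _ "leaf v"]) (auto simp: vx_eq_iff eq_commute[of v])
    then show ?thesis by blast
  qed auto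
qed

lemma finite_verts: "finite sverts"
  by (rule finite_subset[OF verts_subset_images]) auto

lemma card_verts_le: "card sverts \<le> 2 * 4 ^ k + 2 + 3 * (k * M)"
proof -
  let ?A = "(\<lambda>(j, y). vx j y 0) ` ({..<2} \<times> {1..4 ^ k})"
  let ?B = "(\<lambda>(j, i, l). vx j (4 ^ i) l) ` ({..<2} \<times> {..<k} \<times> {1..M})"
  let ?C = "vx 2 1 ` {..k * M}"
  have "card sverts \<le> card ({c} \<union> ?A \<union> ?B \<union> ?C)"
    by (rule card_mono[OF _ verts_subset_images]) auto
  also have "\<dots> \<le> card {c} + card ?A + card ?B + card ?C"
    by (meson add_mono card_Un_le le_trans order_refl)
  also have "card ?A \<le> 2 * 4 ^ k"
    by (rule order_trans[OF card_image_le]) auto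
  also have "card ?B \<le> 2 * (k * M)"
    by (rule order_trans[OF card_image_le]) auto
  also have "card ?C \<le> Suc (k * M)"
    by (rule order_trans[OF card_image_le]) auto
  finally show ?thesis by (simp add: mult.commute)
qed

lemma card_verts_ge: "k * M \<le> card sverts"
proof -
  have "card (vx 2 1 ` {..k * M}) = Suc (k * M)"
    by (subst card_image) (auto simp: inj_on_def vx_eq_iff)
  moreover have "card (vx 2 1 ` {..k * M}) \<le> card sverts"
    by (rule card_mono[OF finite_verts]) (auto simp: sverts_def)
  ultimately show ?thesis by simp
qed

section \<open>The spider as a tree, and walks in it\<close>

lemma simple_tree_T: "simple_tree T"
  unfolding T_def
  by (rule simple_tree_parent_graph[where h = height])
    (use finite_verts c_h_in_verts par_in_verts in force)+

sublocale finite_tree T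
  by unfold_locales (rule simple_tree_T)

lemma V_eq: "V = sverts"
  by (simp add: T_def parent_graph_def)

lemma E_iff: "(u, w) \<in> E \<longleftrightarrow>
    u \<in> sverts \<and> u \<noteq> c \<and> w = par u \<or> w \<in> sverts \<and> w \<noteq> c \<and> u = par w"
  by (auto simp: T_def parent_graph_def parent_rel_def)

text \<open>The condition on \<open>pos\<close> excludes \<open>c\<close>, which is coded in part 0.
  The value 2 gives the star.\<close>

definition leg :: "nat \<Rightarrow> nat set" where
  "leg j = {v. part v = j \<and> 1 \<le> pos v}"

lemma sverts_cases:
  assumes "v \<in> V"
  obtains "v = c" | j where "j < 2" "v \<in> leg j" | "v \<in> leg 2"
  using assms pos_verts[of v] unfolding V_eq leg_def by force

lemma par_simps:
  "part (par v) = (if leaf v = 0 \<and> pos v \<le> 1 then 0 else part v)"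
  "pos (par v) = (if leaf v = 0 then pos v - 1 else pos v)"
  "leaf (par v) = 0"
  by (auto simp: par_def)

text \<open>The outer part of a leg, from position \<open>x\<close> on, is attached to the rest only
  at the spine vertex at \<open>x\<close>. This supplies the separating vertices for
  \<open>separated_closer\<close>.\<close>

lemma tail_exit:
  assumes "(u, w) \<in> E" "u \<in> leg j" "x \<le> pos u" "\<not> (w \<in> leg j \<and> x \<le> pos w)" "1 \<le> x"
  shows "u = vx j x 0" "x = 1 \<Longrightarrow> w = c"
proof -
  have "w = par u \<and> leaf u = 0 \<and> pos u = x"
    using assms pos_verts(1)[of w] unfolding E_iff leg_def by (auto simp: par_simps split: if_splits)
  then show "u = vx j x 0" "x = 1 \<Longrightarrow> w = c"
    using assms(2) by (auto simp: leg_def vx_eq_iff eq_commute[of u] par_def)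
qed

lemma walk_to_c:
  assumes "v \<in> V"
  shows "(v, c) \<in> E ^^ height v"
  using assms
proof (induction "height v" arbitrary: v)
  case 0
  then have "v = c" using par_in_verts(3)[of v] by (auto simp: V_eq)
  then show ?case by (simp add: height_def)
next
  case (Suc n)
  then have "v \<noteq> c" by (auto simp: height_def)
  then have v: "par v \<in> V" "n = height (par v)" "(v, par v) \<in> E"
    using Suc.hyps(2) Suc.prems par_in_verts[of v] by (auto simp: V_eq E_iff)
  then have "(v, c) \<in> E ^^ Suc n"
    using Suc.hyps(1)[OF v(2,1)] relpow_Suc_I2 by metis
  then show ?case using Suc.hyps(2) by simp
qed

lemma walk_to_leg_start:
  assumes "v \<in> V" "v \<in> leg j"
  shows "(v, vx j 1 0) \<in> E ^^ (height v - 1)"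
  using assms
proof (induction "height v" arbitrary: v)
  case 0
  then show ?case by (auto simp: height_def leg_def)
next
  case (Suc n)
  show ?case
  proof (cases n)
    case 0
    then have "v = vx j 1 0"
      using Suc by (auto simp: height_def leg_def vx_eq_iff eq_commute[of v] split: if_splits)
    then show ?thesis by (simp add: height_def)
  next
    case (Suc m)
    then have "\<not> (leaf v = 0 \<and> pos v \<le> 1)" "v \<noteq> c"
      using Suc.hyps(2) Suc.prems by (auto simp: height_def leg_def)
    then have "par v \<in> leg j" "par v \<in> V" "height (par v) = n" "(v, par v) \<in> E"
      using Suc.prems Suc.hyps(2) par_in_verts[of v]
      by (auto simp: V_eq E_iff leg_def par_simps)
    then have "(par v, vx j 1 0) \<in> E ^^ m" "(v, par v) \<in> E"
      using Suc.hyps(1)[of "par v"] Suc by auto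
    then have "(v, vx j 1 0) \<in> E ^^ Suc m" by (metis relpow_Suc_I2)
    moreover have "height v - 1 = Suc m" using Suc.hyps(2) Suc by simp
    ultimately show ?thesis by (simp only:)
  qed
qed

section \<open>Legs secured by B\<close>

definition reach :: "nat \<Rightarrow> nat set \<Rightarrow> nat set" where
  "reach j A = pos ` (A \<inter> leg j)"

text \<open>
  \<open>B\<close>'s answer to an \<open>A\<close>-position may lie further out than the next spine vertex, since \<open>A\<close> may
  already hold that one; then the answer given there serves for both.
\<close>

definition paired :: "nat \<Rightarrow> nat set \<Rightarrow> nat set \<Rightarrow> bool" where
  "paired j A B \<longleftrightarrow> (\<forall>x\<in>reach j A. \<exists>x'>x. {x..<x'} \<subseteq> reach j A \<and> (4 ^ k < x' \<or> vx j x' 0 \<in> B))"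

definition secure :: "nat \<Rightarrow> nat set \<Rightarrow> nat set \<Rightarrow> bool" where
  "secure j A B \<longleftrightarrow> (c \<in> B \<or> vx j 1 0 \<in> B) \<and> paired j A B"

text \<open>If \<open>a\<close> is outside the leg, B's vertex at the inner end separates it from
  \<open>v\<close>. If \<open>a\<close> is further in than \<open>v\<close>, its answer separates
  them. If \<open>a\<close> is further out, it is so far away that the inner end is closer.\<close>

lemma closer_in_secure_leg:
  assumes AB: "A \<subseteq> V" "B \<subseteq> V" "A \<inter> B = {}" and sec: "secure j A B"
    and v: "v \<in> V" "v \<in> leg j"
    and far: "\<And>x. x \<in> reach j A \<Longrightarrow> pos v \<le> x \<Longrightarrow> 2 * pos v + 1 < x"
    and a: "a \<in> A"
  shows "\<exists>b\<in>B. graph_dist T v b < graph_dist T v a"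
proof (cases "a \<in> leg j")
  case False
  show ?thesis
  proof (cases "c \<in> B")
    case True
    have "\<exists>b\<in>{c}. graph_dist T v b < graph_dist T v a"
    proof (rule separated_closer[of v "- (leg j \<union> {c})"])
      show "u \<in> {c}" if "(u, w) \<in> E" "u \<notin> - (leg j \<union> {c})" "w \<in> - (leg j \<union> {c})" for u w
        using tail_exit(2)[OF that(1), of j 1] that(2,3) by (auto simp: leg_def)
    qed (use v a AB True False in auto)
    then show ?thesis using True by blast
  next
    case False
    then have start: "vx j 1 0 \<in> B" using sec by (simp add: secure_def)
    have "\<exists>b\<in>{vx j 1 0}. graph_dist T v b < graph_dist T v a"
    proof (rule separated_closer[of v "- leg j"])
      show "u \<in> {vx j 1 0}" if "(u, w) \<in> E" "u \<notin> - leg j" "w \<in> - leg j" for u w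
        using tail_exit(1)[OF that(1), of j 1] that(2,3) by (auto simp: leg_def)
    qed (use v a AB \<open>a \<notin> leg j\<close> in auto)
    then show ?thesis using start by blast
  qed
next
  case True
  define x where "x = pos a"
  have x: "x \<in> reach j A" using True a by (auto simp: reach_def x_def)
  have aV: "a \<in> V" using a AB by blast
  show ?thesis
  proof (cases "x < pos v")
    case True
    obtain x' where x': "x < x'" "{x..<x'} \<subseteq> reach j A" "4 ^ k < x' \<or> vx j x' 0 \<in> B"
      using sec x unfolding secure_def paired_def by blast
    \<comment> \<open>All positions from \<open>x\<close> up to the answer \<open>x'\<close> are
      reached by A, whereas that of \<open>v\<close> is not, so the answer lies no further out than
      \<open>v\<close>.\<close>
    have "pos v \<notin> reach j A" using far[of "pos v"] by auto
    then have "x' \<le> pos v" using x'(2) True by (meson atLeastLessThan_iff less_imp_le not_le subsetD)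
    then have x'B: "vx j x' 0 \<in> B"
      using x'(3) pos_verts(2)[of v] v(1) by (auto simp: V_eq)
    define S where "S = - {u. u \<in> leg j \<and> x' \<le> pos u}"
    have "\<exists>b\<in>{vx j x' 0}. graph_dist T v b < graph_dist T v a"
    proof (rule separated_closer[of v S])
      show "u \<in> {vx j x' 0}" if "(u, w) \<in> E" "u \<notin> S" "w \<in> S" for u w
        using tail_exit(1)[OF that(1), of j x'] that(2,3) x'(1) by (auto simp: S_def)
    qed (use v aV \<open>x' \<le> pos v\<close> x'(1) in \<open>auto simp: S_def x_def\<close>)
    then show ?thesis using x'B by blast
  next
    case False
    then have "2 * pos v + 1 < x" using far[OF x] by simp
    \<comment> \<open>The position along leg \<open>j\<close> is a potential. By \<open>far\<close>
      it differs between \<open>a\<close> and \<open>v\<close> by more than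
      \<open>pos v + 1\<close>, hence by more than \<open>height v\<close>, which bounds the walk
      from \<open>v\<close> to B's inner end.\<close>
    let ?f = "\<lambda>u. if part u = j then pos u else 0"
    have "ereal (real (?f a) - real (?f v)) \<le> graph_dist T v a"
    proof (rule graph_dist_ge_potential)
      show "?f w \<le> Suc (?f u)" if "(u, w) \<in> E" for u w
        using that unfolding E_iff by (auto simp: par_simps split: if_splits)
    qed (use v aV in auto)
    moreover have "real (height v) < real (?f a) - real (?f v)"
      using \<open>2 * pos v + 1 < x\<close> v(2) \<open>a \<in> leg j\<close> by (auto simp: x_def leg_def height_def)
    ultimately have far_a: "ereal (real (height v)) < graph_dist T v a"
      by (meson less_ereal.simps(1) less_le_trans)
    have near: "\<exists>b\<in>B. graph_dist T v b < graph_dist T v a"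
      if b: "b \<in> B" "(v, b) \<in> E ^^ m" "m \<le> height v" for b m
    proof -
      have "graph_dist T v b \<le> ereal (real m)" by (rule graph_dist_le[OF v(1) b(2)])
      also have "\<dots> \<le> ereal (real (height v))" using b(3) by simp
      also note far_a
      finally show ?thesis using b(1) by blast
    qed
    show ?thesis
      using sec near[OF _ walk_to_c[OF v(1)]] near[OF _ walk_to_leg_start[OF v]]
      by (auto simp: secure_def)
  qed
qed

section \<open>What B wins in a secured part\<close>

definition gain :: "nat \<Rightarrow> nat set \<Rightarrow> nat set \<Rightarrow> nat set" where
  "gain j A B = {v \<in> V. part v = j \<and> graph_setdist T v B < graph_setdist T v A}"

lemma finite_gain: "finite (gain j A B)"
  using finite_V by (simp add: gain_def)

text \<open>The bunch at \<open>4 ^ i\<close> can fail only if A has a position between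
  \<open>4 ^ i\<close> and \<open>2 * 4 ^ i + 1\<close>. These intervals are disjoint for different
  \<open>i\<close>, so the at most \<open>t\<close> vertices of A spoil at most \<open>t\<close>
  bunches.\<close>

lemma card_gain_leg:
  assumes AB: "A \<subseteq> V" "B \<subseteq> V" "A \<inter> B = {}" "A \<noteq> {}" "card A \<le> t"
    and "j < 2" and sec: "secure j A B"
  shows "(k - t) * M \<le> card (gain j A B)"
proof -
  have finA: "finite A" using AB(1) finite_V finite_subset by blast
  define near where "near i x \<longleftrightarrow> 4 ^ i \<le> x \<and> x \<le> 2 * 4 ^ i + 1" for i x :: nat
  define Bad where "Bad = {i \<in> {..<k}. \<exists>x\<in>reach j A. near i x}"
  have near_unique: "i = i'" if "near i x" "near i' x" for i i' x
  proof -
    have "\<not> i < i'" if "near i x" "near i' x" for i i'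
    proof
      assume "i < i'"
      then have "(4 :: nat) ^ Suc i \<le> 4 ^ i'" by (intro power_increasing) auto
      moreover have "(1 :: nat) \<le> 4 ^ i" by simp
      ultimately show False using that unfolding near_def power_Suc by linarith
    qed
    then show ?thesis using that by (meson nat_neq_iff)
  qed
  have "\<forall>i\<in>Bad. \<exists>x. x \<in> reach j A \<and> near i x" by (auto simp: Bad_def)
  then obtain g where g: "\<And>i. i \<in> Bad \<Longrightarrow> g i \<in> reach j A \<and> near i (g i)" by metis
  have "inj_on g Bad" using g near_unique by (metis inj_onI)
  then have "card Bad \<le> card (reach j A)"
    by (rule card_inj_on_le) (use g finA in \<open>auto simp: reach_def\<close>)
  also have "\<dots> \<le> card (A \<inter> leg j)" unfolding reach_def using finA by (intro card_image_le) auto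
  also have "\<dots> \<le> card A" using finA by (intro card_mono) auto
  finally have Bad: "card Bad \<le> t" using AB(5) by simp
  define L where "L = (\<lambda>(i, l). vx j (4 ^ i) l) ` (({..<k} - Bad) \<times> {1..M})"
  have "card L = card (({..<k} - Bad) \<times> {1..M})"
    unfolding L_def by (rule card_image) (auto simp: inj_on_def vx_eq_iff)
  also have "\<dots> = (k - card Bad) * M"
    using card_Diff_subset[of Bad "{..<k}"] by (auto simp: card_cartesian_product Bad_def)
  finally have "(k - t) * M \<le> card L" using Bad by (simp add: diff_le_mono2)
  moreover have "L \<subseteq> gain j A B"
  proof
    fix v assume "v \<in> L"
    then obtain i l where il: "i < k" "i \<notin> Bad" "1 \<le> l" "l \<le> M" "v = vx j (4 ^ i) l"
      by (auto simp: L_def)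
    then have v: "v \<in> V" "v \<in> leg j" "pos v = 4 ^ i"
      using \<open>j < 2\<close> by (auto simp: V_eq sverts_def leg_def)
    have "graph_setdist T v B < graph_setdist T v A"
    proof (rule setdist_less[OF finA AB(4)])
      show "\<exists>b\<in>B. graph_dist T v b < graph_dist T v a" if "a \<in> A" for a
      proof (rule closer_in_secure_leg[OF AB(1-3) sec v(1,2) _ that])
        show "2 * pos v + 1 < x" if "x \<in> reach j A" "pos v \<le> x" for x
          using that il(1,2) v(3) by (auto simp: Bad_def near_def not_le)
      qed
    qed
    then show "v \<in> gain j A B" using v by (simp add: gain_def leg_def)
  qed
  ultimately show ?thesis
    using card_mono[OF finite_gain] le_trans by blast
qed

text \<open>B at \<open>h\<close> wins every leaf that A does not occupy; if A has avoided the star,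
  B at \<open>c\<close> wins all leaves. At most \<open>t\<close> leaves are lost, and
  \<open>t\<close> is at most \<open>t * M\<close>.\<close>

lemma card_gain_star:
  assumes AB: "A \<subseteq> V" "B \<subseteq> V" "A \<inter> B = {}" "A \<noteq> {}" "card A \<le> t"
    and sec: "h \<in> B \<or> c \<in> B \<and> A \<inter> leg 2 = {}"
  shows "(k - t) * M \<le> card (gain 2 A B)"
proof -
  have finA: "finite A" using AB(1) finite_V finite_subset by blast
  define L where "L = vx 2 1 ` {1..k * M} - A"
  have "card (vx 2 1 ` {1..k * M}) = k * M"
    by (subst card_image) (auto simp: inj_on_def vx_eq_iff)
  then have "k * M - card A \<le> card L"
    unfolding L_def using diff_card_le_card_Diff[OF finA] by metis
  moreover have "t \<le> t * M" using M_ge by simp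
  ultimately have "(k - t) * M \<le> card L"
    using AB(5) unfolding diff_mult_distrib by linarith
  moreover have "L \<subseteq> gain 2 A B"
  proof
    fix v assume "v \<in> L"
    then obtain l where l: "1 \<le> l" "l \<le> k * M" "v = vx 2 1 l" "v \<notin> A" by (auto simp: L_def)
    then have v: "v \<in> V" "v \<in> leg 2" "v \<noteq> c" by (auto simp: V_eq sverts_def leg_def eq_c_iff)
    have "graph_setdist T v B < graph_setdist T v A"
    proof (rule setdist_less[OF finA AB(4)])
      fix a assume a: "a \<in> A"
      show "\<exists>b\<in>B. graph_dist T v b < graph_dist T v a"
      proof (cases "h \<in> B")
        case True
        have "\<exists>b\<in>{h}. graph_dist T v b < graph_dist T v a"
        proof (rule separated_closer[of v "- {v, h}"])
          show "u \<in> {h}" if "(u, w) \<in> E" "u \<notin> - {v, h}" "w \<in> - {v, h}" for u w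
          proof (rule ccontr)
            assume "u \<notin> {h}"
            then have "u = v" using that by blast
            then have "w = par v"
              using that(1) l(1,3) unfolding E_iff by (metis par_simps(3) vx_simps(3) not_one_le_zero)
            then show False using that(3) l by (simp add: par_def h_def)
          qed
        qed (use v a AB True l in auto)
        then show ?thesis using True by blast
      next
        case False
        then have c: "c \<in> B" "A \<inter> leg 2 = {}" using sec by auto
        have "\<exists>b\<in>{c}. graph_dist T v b < graph_dist T v a"
        proof (rule separated_closer[of v "- (leg 2 \<union> {c})"])
          show "u \<in> {c}" if "(u, w) \<in> E" "u \<notin> - (leg 2 \<union> {c})" "w \<in> - (leg 2 \<union> {c})" for u w
            using tail_exit(2)[OF that(1), of 2 1] that(2,3) by (auto simp: leg_def)
        qed (use v a AB c in auto)
        then show ?thesis using c by blast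
      qed
    qed
    then show "v \<in> gain 2 A B" using v by (simp add: gain_def leg_def)
  qed
  ultimately show ?thesis
    using card_mono[OF finite_gain] le_trans by blast
qed

section \<open>B's strategy\<close>

lemma paired_insert:
  assumes "paired j A B"
    and "a \<in> leg j \<Longrightarrow> 4 ^ k < Suc (pos a) \<or> vx j (Suc (pos a)) 0 \<in> A \<union> insert b B"
  shows "paired j (insert a A) (insert b B)"
proof (cases "a \<in> leg j")
  case False
  then have "reach j (insert a A) = reach j A" by (auto simp: reach_def)
  then show ?thesis using assms(1) unfolding paired_def by blast
next
  case True
  then have reach: "reach j (insert a A) = insert (pos a) (reach j A)" by (auto simp: reach_def)
  have old: "\<exists>x'>x. {x..<x'} \<subseteq> reach j (insert a A) \<and> (4 ^ k < x' \<or> vx j x' 0 \<in> insert b B)"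
    if "x \<in> reach j A" for x
    using that assms(1) unfolding paired_def reach by blast
  have "\<exists>x'>pos a. {pos a..<x'} \<subseteq> reach j (insert a A) \<and> (4 ^ k < x' \<or> vx j x' 0 \<in> insert b B)"
  \<comment> \<open>If A already holds the next spine vertex, the run of A-positions leading to its
    answer extends one step inwards.\<close>
  proof (cases "vx j (Suc (pos a)) 0 \<in> A")
    case True
    then have "Suc (pos a) \<in> reach j A" by (force simp: reach_def leg_def)
    then obtain x' where x': "x' > Suc (pos a)" "{Suc (pos a)..<x'} \<subseteq> reach j (insert a A)"
      "4 ^ k < x' \<or> vx j x' 0 \<in> insert b B"
      using old by blast
    have "{pos a..<x'} = insert (pos a) {Suc (pos a)..<x'}" using x'(1) by auto
    then have "{pos a..<x'} \<subseteq> reach j (insert a A)" using x'(2) reach by auto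
    then show ?thesis using x'(1,3) Suc_lessD by blast
  next
    case False
    then have "4 ^ k < Suc (pos a) \<or> vx j (Suc (pos a)) 0 \<in> insert b B"
      using assms(2) \<open>a \<in> leg j\<close> by blast
    moreover have "{pos a..<Suc (pos a)} \<subseteq> reach j (insert a A)" using reach by auto
    ultimately show ?thesis by blast
  qed
  then show ?thesis
    using old unfolding paired_def reach by blast
qed

definition legal :: "nat \<Rightarrow> nat set \<Rightarrow> nat set \<Rightarrow> bool" where
  "legal s A B \<longleftrightarrow> A \<subseteq> V \<and> B \<subseteq> V \<and> A \<inter> B = {} \<and> card A + s = t \<and> card B + s = t"

lemma legal_finite: "legal s A B \<Longrightarrow> finite A \<and> finite B"
  using finite_V finite_subset unfolding legal_def by blast

lemma legal_insert:
  assumes "legal (Suc s) A B" "a \<in> V - (A \<union> B)" "b \<in> V - (insert a A \<union> B)"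
  shows "legal s (insert a A) (insert b B)"
  using assms legal_finite[OF assms(1)] unfolding legal_def by auto

lemma legal_free:
  assumes "legal (Suc s) A B"
  shows "V - (insert a A \<union> B) \<noteq> {}"
proof
  assume "V - (insert a A \<union> B) = {}"
  then have "card V \<le> card (insert a A \<union> B)"
    using legal_finite[OF assms] by (intro card_mono) auto
  also have "\<dots> \<le> Suc (card A) + card B"
    by (rule order_trans[OF card_Un_le]) (use legal_finite[OF assms] in \<open>simp add: card_insert_if\<close>)
  also have "\<dots> < 2 * t" using assms unfolding legal_def by simp
  also have "\<dots> \<le> k * M" using t_less M_ge mult_le_mono[of t k 2 M] by simp
  also have "\<dots> \<le> card V" using card_verts_ge by (simp add: V_eq)
  finally show False by simp
qed

text \<open>If B already holds \<open>v\<close>, any free vertex will do: \<open>paired\<close>,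
  \<open>secure\<close> and \<open>winning\<close> survive additional vertices of B.\<close>

lemma reply_at:
  assumes "legal (Suc s) A B" "v \<in> V" "v \<notin> insert a A"
  obtains b where "b \<in> V - (insert a A \<union> B)" "v \<in> insert b B"
proof (cases "v \<in> B")
  case True
  then show thesis using legal_free[OF assms(1), of a] that by blast
next
  case False
  then show thesis using assms that[of v] by blast
qed

text \<open>One answer preserves the pairing on both legs, since \<open>a\<close> lies on at most
  one of them.\<close>

lemma reply_paired:
  assumes legal: "legal (Suc s) A B" and a: "a \<in> V - (A \<union> B)"
  obtains b where "b \<in> V - (insert a A \<union> B)"
    "\<And>j. j < 2 \<Longrightarrow> paired j A B \<Longrightarrow> paired j (insert a A) (insert b B)"
proof -
  note witness = that
  let ?n = "vx (part a) (Suc (pos a)) 0"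
  have key: thesis if "b \<in> V - (insert a A \<union> B)"
    "a \<in> leg (part a) \<Longrightarrow> part a < 2 \<Longrightarrow> 4 ^ k < Suc (pos a) \<or> ?n \<in> A \<union> insert b B" for b
  proof (rule witness[OF that(1)])
    fix j :: nat assume "j < 2" "paired j A B"
    then show "paired j (insert a A) (insert b B)"
      using that(2) by (intro paired_insert) (auto simp: leg_def)
  qed
  show thesis
  proof (cases "part a < 2 \<and> Suc (pos a) \<le> 4 ^ k \<and> ?n \<notin> A")
    case True
    then have "?n \<in> V" using spine_in_verts by (simp add: V_eq)
    moreover have "?n \<noteq> a" by (auto simp: vx_eq_iff)
    ultimately obtain b where "b \<in> V - (insert a A \<union> B)" "?n \<in> insert b B"
      using reply_at[OF legal, of ?n a] True by blast
    then show thesis using key by blast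
  next
    case False
    then show thesis using legal_free[OF legal, of a] key by (metis Un_iff ex_in_conv not_le)
  qed
qed

text \<open>
  In the third alternative the single \<open>A\<close>-vertex of leg \<open>i\<close> need not have been answered yet: \<open>B\<close> answers
  it as soon as \<open>A\<close> enters the star, and takes \<open>h\<close> as soon as \<open>A\<close> plays in leg \<open>i\<close> again.
\<close>

definition winning :: "nat set \<Rightarrow> nat set \<Rightarrow> bool" where
  "winning A B \<longleftrightarrow>
     c \<in> B \<and> paired 0 A B \<and> paired 1 A B \<or>
     (\<exists>j<2. h \<in> B \<and> secure j A B) \<or>
     (\<exists>i<2. \<exists>j<2. i \<noteq> j \<and> c \<in> B \<and> A \<inter> leg 2 = {} \<and> paired j A B \<and>
        (\<exists>a. A \<inter> leg i \<subseteq> {a}))"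

text \<open>The first two alternatives persist under the paired reply. The third turns into the
  first when A enters the star, into the second when A plays in leg \<open>i\<close>, and persists
  when A plays in leg \<open>j\<close>.\<close>

lemma winning_step:
  assumes legal: "legal (Suc s) A B" and a: "a \<in> V - (A \<union> B)" and win: "winning A B"
  obtains b where "b \<in> V - (insert a A \<union> B)" "winning (insert a A) (insert b B)"
proof -
  obtain b\<^sub>0 where b\<^sub>0: "b\<^sub>0 \<in> V - (insert a A \<union> B)"
    "\<And>j. j < 2 \<Longrightarrow> paired j A B \<Longrightarrow> paired j (insert a A) (insert b\<^sub>0 B)"
    using reply_paired[OF legal a] by blast
  consider (legs) "c \<in> B" "paired 0 A B" "paired 1 A B"
    | (star) j where "j < 2" "h \<in> B" "secure j A B"
    | (wait) i j a' where "i < 2" "j < 2" "i \<noteq> j" "c \<in> B" "A \<inter> leg 2 = {}" "paired j A B" "A \<inter> leg i \<subseteq> {a'}"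
    using win unfolding winning_def by blast
  then show thesis
  proof cases
    case legs
    then have "winning (insert a A) (insert b\<^sub>0 B)" using b\<^sub>0(2) unfolding winning_def by auto
    then show thesis using that b\<^sub>0(1) by blast
  next
    case (star j)
    then have "winning (insert a A) (insert b\<^sub>0 B)"
      using b\<^sub>0(2)[of j] unfolding winning_def secure_def by auto
    then show thesis using that b\<^sub>0(1) by blast
  next
    case (wait i j a')
    have "a \<noteq> c" using a wait(4) by blast
    then consider "a \<in> leg 2" | "a \<in> leg i" | "a \<in> leg j"
      using sverts_cases[of a] a wait(1-3) by (metis DiffD1 less_2_cases_iff)
    then show thesis
    proof cases
      case 1
      obtain b where b: "b \<in> V - (insert a A \<union> B)"
        "\<And>x. x \<in> A \<inter> leg i \<Longrightarrow> 4 ^ k < Suc (pos x) \<or> vx i (Suc (pos x)) 0 \<in> insert b B"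
      proof (cases "A \<inter> leg i \<noteq> {} \<and> Suc (pos a') \<le> 4 ^ k")
        case True
        let ?v = "vx i (Suc (pos a')) 0"
        have "?v \<in> V" using True spine_in_verts wait(1) by (simp add: V_eq)
        moreover have "?v \<in> leg i" "?v \<noteq> a'" by (auto simp: leg_def vx_eq_iff)
        then have "?v \<notin> insert a A" using wait(1,7) 1 by (auto simp: leg_def)
        ultimately obtain b where "b \<in> V - (insert a A \<union> B)" "?v \<in> insert b B"
          using reply_at[OF legal] by blast
        then show thesis using that wait(7) by blast
      next
        case False
        then show thesis using that[OF b\<^sub>0(1)] wait(7) by (metis empty_iff not_le singletonD subsetD)
      qed
      \<comment> \<open>A has at most one vertex on leg \<open>i\<close>, now answered directly, so
        the run in \<open>paired\<close> can be taken of length 1.\<close>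
      have "reach i (insert a A) = pos ` (A \<inter> leg i)" using 1 wait(1) by (auto simp: reach_def leg_def)
      then have "paired i (insert a A) (insert b B)"
        using b(2) unfolding paired_def by (force intro!: exI[of _ "Suc _"])
      moreover have "paired j (insert a A) (insert b B)"
        by (rule paired_insert[OF wait(6)]) (use 1 wait(2) in \<open>auto simp: leg_def\<close>)
      ultimately have "winning (insert a A) (insert b B)"
        using wait(1-4) unfolding winning_def by (auto simp: less_2_cases_iff)
      then show thesis using that b(1) by blast
    next
      case 2
      have "h \<notin> insert a A" using wait(1,5) 2 by (auto simp: leg_def)
      then obtain b where b: "b \<in> V - (insert a A \<union> B)" "h \<in> insert b B"
        using reply_at[OF legal, of h a] c_h_in_verts by (auto simp: V_eq)
      have "paired j (insert a A) (insert b B)"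
        by (rule paired_insert[OF wait(6)]) (use 2 wait(3) in \<open>auto simp: leg_def\<close>)
      then have "winning (insert a A) (insert b B)"
        using wait(2,4) b(2) unfolding winning_def secure_def by auto
      then show thesis using that b(1) by blast
    next
      case 3
      have "insert a A \<inter> leg 2 = {}" "insert a A \<inter> leg i \<subseteq> {a'}"
        using 3 wait by (auto simp: leg_def)
      then have "winning (insert a A) (insert b\<^sub>0 B)"
        using wait(1-4) b\<^sub>0(2)[OF wait(2,6)] unfolding winning_def by blast
      then show thesis using that b\<^sub>0(1) by blast
    qed
  qed
qed

text \<open>The first two alternatives are the empty board and the position after A opens at
  \<open>c\<close>. The bounds on \<open>s\<close> keep them from being final, so that at the end
  only \<open>winning\<close> remains.\<close>

definition inv :: "nat \<Rightarrow> nat set \<Rightarrow> nat set \<Rightarrow> bool" where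
  "inv s A B \<longleftrightarrow> legal s A B \<and>
     (2 \<le> s \<and> A = {} \<and> B = {} \<or> 1 \<le> s \<and> A = {c} \<and> B = {h} \<or> winning A B)"

lemma inv_step:
  assumes inv: "inv (Suc s) A B" and a: "a \<in> V - (A \<union> B)"
  shows "\<exists>b\<in>V - (insert a A \<union> B). inv s (insert a A) (insert b B)"
proof -
  have legal: "legal (Suc s) A B" using inv by (simp add: inv_def)
  have ch: "c \<in> V" "h \<in> V" "c \<noteq> h" using c_h_in_verts by (auto simp: V_eq eq_c_iff eq_commute[of c])
  consider (start) "1 \<le> s" "A = {}" "B = {}" | (second) "A = {c}" "B = {h}" | (win) "winning A B"
    using inv by (auto simp: inv_def)
  then show ?thesis
  proof cases
    case start
    show ?thesis
    proof (cases "a = c")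
      case True
      then have "h \<in> V - (insert a A \<union> B)" using ch start by auto
      moreover have "inv s (insert a A) (insert h B)"
        unfolding inv_def using legal_insert[OF legal a calculation] True start by simp
      ultimately show ?thesis by blast
    next
      case False
      then have c: "c \<in> V - (insert a A \<union> B)" using ch start by auto
      have "winning {a} {c}"
      proof -
        have "a \<in> V" using a by blast
        then show ?thesis
        proof (cases rule: sverts_cases)
          case 1
          with False show ?thesis by blast
        next
          case (2 j)
          \<comment> \<open>A has opened on leg \<open>j\<close>, which becomes the waiting leg in
            the third alternative of \<open>winning\<close>; the other leg is still free of
            A.\<close>
          obtain i :: nat where i: "i < 2" "j \<noteq> i"
            by (metis zero_less_numeral one_less_numeral_iff semiring_norm(76) zero_neq_one)
          have "{a} \<inter> leg i = {}" "{a} \<inter> leg 2 = {}" using 2 i by (auto simp: leg_def)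
          then have "j < 2 \<and> i < 2 \<and> j \<noteq> i \<and> c \<in> {c} \<and> {a} \<inter> leg 2 = {} \<and> paired i {a} {c} \<and>
              {a} \<inter> leg j \<subseteq> {a}"
            using 2(1) i by (simp add: paired_def reach_def)
          then show ?thesis unfolding winning_def by blast
        next
          case 3
          then have "{a} \<inter> leg 0 = {}" "{a} \<inter> leg 1 = {}" by (auto simp: leg_def)
          then show ?thesis unfolding winning_def paired_def reach_def by simp
        qed
      qed
      then have "inv s (insert a A) (insert c B)"
        unfolding inv_def using legal_insert[OF legal a c] start by simp
      then show ?thesis using c by blast
    qed
  next
    case second
    \<comment> \<open>The second move of A enters at most one leg; B takes the inner end of the
      other and, with \<open>h\<close>, reaches the second alternative.\<close>
    obtain j :: nat where j: "j < 2" "a \<notin> leg j"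
    proof (cases "a \<in> leg 0")
      case True
      then show thesis using that[of 1] by (auto simp: leg_def)
    next
      case False
      then show thesis using that[of 0] by simp
    qed
    let ?b = "vx j 1 0"
    have "?b \<in> leg j" "?b \<notin> {c, h}" using j(1) by (auto simp: leg_def vx_eq_iff)
    then have b: "?b \<in> V - (insert a A \<union> B)"
      using j spine_in_verts[of j 1] second by (auto simp: V_eq)
    have "insert a A \<inter> leg j = {}" using j second by (auto simp: leg_def)
    then have "winning (insert a A) (insert ?b B)"
      unfolding winning_def secure_def paired_def reach_def using j(1) second by auto
    then show ?thesis using b legal_insert[OF legal a b] unfolding inv_def by blast
  next
    case win
    then show ?thesis
      using winning_step[OF legal a] legal_insert[OF legal a] unfolding inv_def by metis
  qed
qed

text \<open>Every alternative secures two different parts, whose gains are disjoint. The assumption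
  \<open>0 < t\<close> ensures that A holds a vertex.\<close>

lemma share_of_winning:
  assumes legal: "legal 0 A B" and win: "winning A B" and "0 < t"
  shows "voronoi_share T A B \<le> 1 - 2 * real ((k - t) * M) / real (card V)"
proof -
  have AB: "A \<subseteq> V" "B \<subseteq> V" "A \<inter> B = {}" "A \<noteq> {}" "card A \<le> t"
    using legal \<open>0 < t\<close> by (auto simp: legal_def)
  have leg: "(k - t) * M \<le> card (gain j A B)" if "j < 2" "secure j A B" for j
    by (rule card_gain_leg[OF AB that])
  have star: "(k - t) * M \<le> card (gain 2 A B)" if "h \<in> B \<or> c \<in> B \<and> A \<inter> leg 2 = {}"
    by (rule card_gain_star[OF AB that])
  have "\<exists>i j. i \<noteq> j \<and> (k - t) * M \<le> card (gain i A B) \<and> (k - t) * M \<le> card (gain j A B)"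
  proof -
    consider "secure 0 A B" "secure 1 A B" | j where "j < 2" "h \<in> B" "secure j A B"
      | j where "j < 2" "c \<in> B" "A \<inter> leg 2 = {}" "secure j A B"
      using win unfolding winning_def secure_def by blast
    then show ?thesis
    proof cases
      case 1
      then show ?thesis using leg[of 0] leg[of 1] by (intro exI[of _ 0] exI[of _ 1]) auto
    next
      case (2 j)
      then show ?thesis using leg[of j] star by (intro exI[of _ j] exI[of _ 2]) auto
    next
      case (3 j)
      then show ?thesis using leg[of j] star by (intro exI[of _ j] exI[of _ 2]) auto
    qed
  qed
  then obtain i j where ij: "i \<noteq> j" "(k - t) * M \<le> card (gain i A B)" "(k - t) * M \<le> card (gain j A B)"
    by blast
  let ?W = "gain i A B \<union> gain j A B"
  have "card ?W = card (gain i A B) + card (gain j A B)"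
    using finite_gain ij(1) by (intro card_Un_disjoint) (auto simp: gain_def)
  then have "2 * ((k - t) * M) \<le> card ?W" using ij by simp
  then have "2 * real ((k - t) * M) \<le> real (card ?W)"
    by (metis of_nat_le_iff of_nat_mult of_nat_numeral)
  moreover have "voronoi_share T A B * real (card V) \<le> real (card V) - real (card ?W)"
    by (rule share_upper) (auto simp: gain_def)
  ultimately have "voronoi_share T A B * real (card V) \<le> real (card V) - 2 * real ((k - t) * M)"
    by linarith
  moreover have "0 < card V" using V_nonempty finite_V by (simp add: card_gt_0_iff)
  ultimately have "voronoi_share T A B \<le> (real (card V) - 2 * real ((k - t) * M)) / real (card V)"
    by (simp only: pos_le_divide_eq of_nat_0_less_iff)
  also have "\<dots> = 1 - 2 * real ((k - t) * M) / real (card V)"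
    using \<open>0 < card V\<close> V_nonempty by (simp add: diff_divide_distrib)
  finally show ?thesis .
qed

theorem VR_le:
  assumes "2 \<le> t"
  shows "VR T t \<le> 1 - 2 * real ((k - t) * M) / real (card V)"
  unfolding VR_def
proof (rule voronoi_value_le_invariant[of inv])
  show "inv t {} {}" using assms by (simp add: inv_def legal_def)
  show "V - (A \<union> B) \<noteq> {}" if "inv (Suc s) A B" for s A B
    using legal_free[of s A B undefined] that unfolding inv_def by blast
  show "voronoi_share T A B \<le> 1 - 2 * real ((k - t) * M) / real (card V)" if "inv 0 A B" for A B
    using that share_of_winning assms by (auto simp: inv_def)
qed (rule inv_step)

end

theorem theorem4:
  shows "(\<forall>T :: 'a pair_pre_digraph.
            simple_tree T \<and> 4 \<le> card (pverts T) \<longrightarrow> VR T 2 > 1 / 3) \<and>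
         (\<forall>\<epsilon> :: real. \<forall>t :: nat. 0 < \<epsilon> \<and> 2 \<le> t \<longrightarrow>
            (\<exists>T :: nat pair_pre_digraph.
               simple_tree T \<and> 2 * t \<le> card (pverts T) \<and> VR T t < 1 / 3 + \<epsilon>))"
proof (intro conjI allI impI)
  fix T :: "'a pair_pre_digraph"
  assume T: "simple_tree T \<and> 4 \<le> card (pverts T)"
  then interpret finite_tree T by unfold_locales simp
  show "VR T 2 > 1 / 3" by (rule VR_2_gt) (use T in simp)
next
  fix \<epsilon> :: real and t :: nat
  assume *: "0 < \<epsilon> \<and> 2 \<le> t"
  \<comment> \<open>Let \<open>n\<close> be the number of vertices. Then
    \<open>2/3 * n - 2 * (k - t) * M\<close> is at most \<open>(2 * t + 1) * M\<close>, which has to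
    be below \<open>\<epsilon> * k * M\<close> and thus below \<open>\<epsilon> * n\<close>.\<close>
  obtain k :: nat where k: "real k > max (real t) ((2 * real t + 1) / \<epsilon>)"
    using reals_Archimedean2 by blast
  \<comment> \<open>This bounds the number of vertices that are not counted as leaves, namely the
    spines, \<open>c\<close> and \<open>h\<close>, so together they cost no more than one
    bunch.\<close>
  define M :: nat where "M = 2 * 4 ^ k + 2"
  interpret S: spider k M t
    by unfold_locales (use k in \<open>auto simp: M_def\<close>)
  let ?n = "real (card (pverts S.T))"
  have kM: "real k * real M \<le> ?n"
    using S.card_verts_ge S.V_eq by (metis of_nat_le_iff of_nat_mult)
  have "card (pverts S.T) \<le> M + 3 * (k * M)"
    using S.card_verts_le S.V_eq by (simp add: M_def)
  then have n_le: "?n \<le> real M + 3 * (real k * real M)"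
    by (metis of_nat_add of_nat_le_iff of_nat_mult of_nat_numeral)
  have "0 < M" by (simp add: M_def)
  then have M: "0 < real M" by simp
  have k': "0 < real k" "t < k" "2 * real t + 1 < \<epsilon> * real k"
    using k * by (auto simp: field_simps)
  have n_pos: "0 < ?n" using kM M k'(1) by (smt (verit) mult_pos_pos)
  have "VR S.T t \<le> 1 - 2 * real ((k - t) * M) / ?n"
    using S.VR_le * by simp
  also have "\<dots> < 1 / 3 + \<epsilon>"
  proof -
    have "(2 * real t + 1) * real M < \<epsilon> * real k * real M"
      using k'(3) M by simp
    also have "\<dots> \<le> \<epsilon> * ?n" using kM * by (simp add: mult.assoc mult_left_mono)
    finally have "2 / 3 * ?n - 2 * ((real k - real t) * real M) < \<epsilon> * ?n"
      using n_le M by (simp add: algebra_simps)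
    moreover have "real ((k - t) * M) = (real k - real t) * real M"
      using k'(2) by simp
    ultimately have "(2 / 3 * ?n - 2 * real ((k - t) * M)) / ?n < \<epsilon>"
      by (simp only: pos_divide_less_eq[OF n_pos])
    then have "2 / 3 * ?n / ?n - 2 * real ((k - t) * M) / ?n < \<epsilon>"
      by (simp only: diff_divide_distrib)
    then show ?thesis using n_pos S.V_nonempty by (simp del: of_nat_mult)
  qed
  finally have "VR S.T t < 1 / 3 + \<epsilon>" .
  moreover have "2 * t \<le> card (pverts S.T)"
    using S.card_verts_ge S.V_eq mult_le_mono[of t k 2 M] k'(2) by (simp add: M_def)
  ultimately show "\<exists>T :: nat pair_pre_digraph.
      simple_tree T \<and> 2 * t \<le> card (pverts T) \<and> VR T t < 1 / 3 + \<epsilon>"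
    using S.simple_tree_T by blast
qed

end
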